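(* Let $X$ be a space, and let $\underline{X}_\bullet$ be the constant simplicial space on $X$, i.e. $\underline{X}_p=X$ for all $p\in\mathbb{N}$ and $\underline{X}_\bullet(\alpha)=\mathrm{id}_X$ for all $\alpha\colon[p]\to[q]$ in $\Delta$. Then there is an equivalence of categories $$\mathsf{cSh}(X)\simeq\mathsf{Sh}(\underline{X}_\bullet)$$ between the category of cosimplicial sheaves on $X$ and the category of sheaves on the simplicial space $\underline{X}_\bullet$.
   Context: Sheaves are sheaves of sets. $\Delta$ is the simplex category. $\mathsf{cSh}(X)=[\Delta,\mathsf{Sh}(X)]$ is the category of cosimplicial objects in the category $\mathsf{Sh}(X)$ of sheaves on $X$. A simplicial space is a functor $X_\bullet\colon\Delta^{\mathrm{op}}\to\mathsf{Space}$, where $\mathsf{Space}$ is a fixed category of suitably nice spaces (e.g. compactly generated topological spaces); for $\alpha\colon[p]\to[q]$ in $\Delta$ write $X_\bullet\alpha\colon X_q\to X_p$. A sheaf $\mathcal{F}^\bullet$ on $X_\bullet$ is the data of a sheaf $\mathcal{F}^p$ on $X_p$ for all $p\in\mathbb{N}$, with morphisms $\mathcal{F}^\bullet\alpha\colon(X_\bullet\alpha)^*\mathcal{F}^p\to\mathcal{F}^q$ for all $\alpha\colon[p]\to[q]$ in $\Delta$, functorial in the sense that $\mathcal{F}^\bullet(\mathrm{id})=\mathrm{id}$ and $\mathcal{F}^\bullet(\beta\circ\alpha)=\mathcal{F}^\bullet(\beta)\circ\mathcal{F}^\bullet(\alpha)$ (where $\mathcal{F}^\bullet(\alpha)$ is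 pulled back along $X_\bullet\beta$, and the canonical isomorphisms $(fg)^*\cong g^*f^*$ are used implicitly). A morphism $\varphi^\bullet\colon\mathcal{F}^\bullet\to\mathcal{G}^\bullet$ is a family of sheaf morphisms $\varphi^p\colon\mathcal{F}^p\to\mathcal{G}^p$ with $\varphi^q\circ\mathcal{F}^\bullet\alpha=\mathcal{G}^\bullet\alpha\circ(X_\bullet\alpha)^*\varphi^p$ for all $\alpha$. The resulting category is $\mathsf{Sh}(X_\bullet)$. *)

theory Defs
  imports "HOL-Analysis.Abstract_Topology"
begin

text \<open>
  Conventions. All maps are functions of HOL that are \<open>undefined\<close> outside their domain
  (\<open>extensional\<close>, \<open>PiE\<close>), so that equality of morphisms is equality in HOL. ``Sets'' are the
  subsets of an arbitrary but fixed type of values.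
\<close>

section \<open>Categories\<close>

record ('o, 'm) cat =
  cobj :: "'o set"
  chom :: "'o \<Rightarrow> 'o \<Rightarrow> 'm set"
  cid :: "'o \<Rightarrow> 'm"
  ccomp :: "'o \<Rightarrow> 'o \<Rightarrow> 'o \<Rightarrow> 'm \<Rightarrow> 'm \<Rightarrow> 'm"

text \<open>The composite of \<open>f : a \<rightarrow> b\<close> and \<open>g : b \<rightarrow> c\<close> is \<open>ccomp C a b c g f\<close>. The objects have to be
  given because the hom-sets need not be disjoint.\<close>

definition category :: "('o, 'm) cat \<Rightarrow> bool" where
  "category C \<longleftrightarrow>
     (\<forall>a\<in>cobj C. cid C a \<in> chom C a a) \<and>
     (\<forall>a\<in>cobj C. \<forall>b\<in>cobj C. \<forall>c\<in>cobj C. \<forall>f\<in>chom C a b. \<forall>g\<in>chom C b c.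
        ccomp C a b c g f \<in> chom C a c) \<and>
     (\<forall>a\<in>cobj C. \<forall>b\<in>cobj C. \<forall>f\<in>chom C a b.
        ccomp C a a b f (cid C a) = f \<and> ccomp C a b b (cid C b) f = f) \<and>
     (\<forall>a\<in>cobj C. \<forall>b\<in>cobj C. \<forall>c\<in>cobj C. \<forall>d\<in>cobj C.
        \<forall>f\<in>chom C a b. \<forall>g\<in>chom C b c. \<forall>h\<in>chom C c d.
        ccomp C a c d h (ccomp C a b c g f) = ccomp C a b d (ccomp C b c d h g) f)"

definition op_cat :: "('o, 'm) cat \<Rightarrow> ('o, 'm) cat" where
  "op_cat C = \<lparr>cobj = cobj C, chom = (\<lambda>a b. chom C b a), cid = cid C,
               ccomp = (\<lambda>a b c g f. ccomp C c b a f g)\<rparr>"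

definition iso_in :: "('o, 'm) cat \<Rightarrow> 'o \<Rightarrow> 'o \<Rightarrow> 'm \<Rightarrow> bool" where
  "iso_in C a b f \<longleftrightarrow> f \<in> chom C a b \<and>
     (\<exists>g\<in>chom C b a. ccomp C a b a g f = cid C a \<and> ccomp C b a b f g = cid C b)"

record ('o, 'm, 'p, 'n) fctr =
  fobj :: "'o \<Rightarrow> 'p"
  fmap :: "'o \<Rightarrow> 'o \<Rightarrow> 'm \<Rightarrow> 'n"

definition is_functor ::
    "('o, 'm) cat \<Rightarrow> ('p, 'n) cat \<Rightarrow> ('o, 'm, 'p, 'n) fctr \<Rightarrow> bool" where
  "is_functor C D F \<longleftrightarrow>
     fobj F \<in> cobj C \<rightarrow>\<^sub>E cobj D \<and>
     fmap F \<in> (\<Pi>\<^sub>E a\<in>cobj C. \<Pi>\<^sub>E b\<in>cobj C. chom C a b \<rightarrow>\<^sub>E chom D (fobj F a) (fobj F b)) \<and>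
     (\<forall>a\<in>cobj C. fmap F a a (cid C a) = cid D (fobj F a)) \<and>
     (\<forall>a\<in>cobj C. \<forall>b\<in>cobj C. \<forall>c\<in>cobj C. \<forall>f\<in>chom C a b. \<forall>g\<in>chom C b c.
        fmap F a c (ccomp C a b c g f) =
        ccomp D (fobj F a) (fobj F b) (fobj F c) (fmap F b c g) (fmap F a b f))"

definition id_functor :: "('o, 'm) cat \<Rightarrow> ('o, 'm, 'o, 'm) fctr" where
  "id_functor C = \<lparr>fobj = (\<lambda>a\<in>cobj C. a),
                   fmap = (\<lambda>a\<in>cobj C. \<lambda>b\<in>cobj C. \<lambda>f\<in>chom C a b. f)\<rparr>"

definition comp_functor ::
    "('o, 'm) cat \<Rightarrow> ('p, 'n, 'q, 'k) fctr \<Rightarrow> ('o, 'm, 'p, 'n) fctr \<Rightarrow> ('o, 'm, 'q, 'k) fctr" where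
  "comp_functor C G F =
     \<lparr>fobj = (\<lambda>a\<in>cobj C. fobj G (fobj F a)),
      fmap = (\<lambda>a\<in>cobj C. \<lambda>b\<in>cobj C. \<lambda>f\<in>chom C a b. fmap G (fobj F a) (fobj F b) (fmap F a b f))\<rparr>"

definition const_functor :: "('o, 'm) cat \<Rightarrow> ('p, 'n) cat \<Rightarrow> 'p \<Rightarrow> ('o, 'm, 'p, 'n) fctr" where
  "const_functor C D d =
     \<lparr>fobj = (\<lambda>a\<in>cobj C. d),
      fmap = (\<lambda>a\<in>cobj C. \<lambda>b\<in>cobj C. \<lambda>f\<in>chom C a b. cid D d)\<rparr>"

definition nat_trans ::
    "('o, 'm) cat \<Rightarrow> ('p, 'n) cat \<Rightarrow> ('o, 'm, 'p, 'n) fctr \<Rightarrow> ('o, 'm, 'p, 'n) fctr \<Rightarrow>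
     ('o \<Rightarrow> 'n) \<Rightarrow> bool" where
  "nat_trans C D F G \<tau> \<longleftrightarrow>
     \<tau> \<in> (\<Pi>\<^sub>E a\<in>cobj C. chom D (fobj F a) (fobj G a)) \<and>
     (\<forall>a\<in>cobj C. \<forall>b\<in>cobj C. \<forall>f\<in>chom C a b.
        ccomp D (fobj F a) (fobj F b) (fobj G b) (\<tau> b) (fmap F a b f) =
        ccomp D (fobj F a) (fobj G a) (fobj G b) (fmap G a b f) (\<tau> a))"

definition nat_iso ::
    "('o, 'm) cat \<Rightarrow> ('p, 'n) cat \<Rightarrow> ('o, 'm, 'p, 'n) fctr \<Rightarrow> ('o, 'm, 'p, 'n) fctr \<Rightarrow>
     ('o \<Rightarrow> 'n) \<Rightarrow> bool" where
  "nat_iso C D F G \<tau> \<longleftrightarrow>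
     nat_trans C D F G \<tau> \<and> (\<forall>a\<in>cobj C. iso_in D (fobj F a) (fobj G a) (\<tau> a))"

definition functor_cat ::
    "('o, 'm) cat \<Rightarrow> ('p, 'n) cat \<Rightarrow> (('o, 'm, 'p, 'n) fctr, 'o \<Rightarrow> 'n) cat" where
  "functor_cat C D =
     \<lparr>cobj = {F. is_functor C D F},
      chom = (\<lambda>F G. {\<tau>. nat_trans C D F G \<tau>}),
      cid = (\<lambda>F. \<lambda>a\<in>cobj C. cid D (fobj F a)),
      ccomp = (\<lambda>F G H \<tau> \<sigma>. \<lambda>a\<in>cobj C. ccomp D (fobj F a) (fobj G a) (fobj H a) (\<tau> a) (\<sigma> a))\<rparr>"

definition equivalent_categories :: "('o, 'm) cat \<Rightarrow> ('p, 'n) cat \<Rightarrow> bool" where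
  "equivalent_categories C D \<longleftrightarrow>
     category C \<and> category D \<and>
     (\<exists>F G \<eta> \<epsilon>. is_functor C D F \<and> is_functor D C G \<and>
        nat_iso C C (id_functor C) (comp_functor C G F) \<eta> \<and>
        nat_iso D D (comp_functor D F G) (id_functor D) \<epsilon>)"


section \<open>Simplicial spaces\<close>

text \<open>The object \<open>p\<close> stands for \<open>[p] = {0, \<dots>, p}\<close>.\<close>

definition simplex_cat :: "(nat, nat \<Rightarrow> nat) cat" where
  "simplex_cat =
     \<lparr>cobj = UNIV,
      chom = (\<lambda>p q. {\<alpha> \<in> {0..p} \<rightarrow>\<^sub>E {0..q}. mono_on {0..p} \<alpha>}),
      cid = (\<lambda>p. \<lambda>i\<in>{0..p}. i),
      ccomp = (\<lambda>p q r \<beta> \<alpha>. compose {0..p} \<beta> \<alpha>)\<rparr>"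

definition top_cat :: "('x topology, 'x \<Rightarrow> 'x) cat" where
  "top_cat =
     \<lparr>cobj = UNIV,
      chom = (\<lambda>X Y. {f \<in> extensional (topspace X). continuous_map X Y f}),
      cid = (\<lambda>X. \<lambda>x\<in>topspace X. x),
      ccomp = (\<lambda>X Y Z g f. compose (topspace X) g f)\<rparr>"

type_synonym 'x simplicial_space = "(nat, nat \<Rightarrow> nat, 'x topology, 'x \<Rightarrow> 'x) fctr"

definition is_simplicial_space :: "'x simplicial_space \<Rightarrow> bool" where
  "is_simplicial_space X \<longleftrightarrow> is_functor (op_cat simplex_cat) top_cat X"

definition constant_simplicial_space :: "'x topology \<Rightarrow> 'x simplicial_space" where
  "constant_simplicial_space X = const_functor (op_cat simplex_cat) top_cat X"


section \<open>Sheaves of sets\<close>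

record ('x, 'a) presheaf =
  sect :: "'x set \<Rightarrow> 'a set"
  res :: "'x set \<Rightarrow> 'x set \<Rightarrow> 'a \<Rightarrow> 'a"

text \<open>For \<open>V \<subseteq> U\<close> the restriction map from \<open>sect F U\<close> to \<open>sect F V\<close> is \<open>res F U V\<close>.\<close>

abbreviation opens :: "'x topology \<Rightarrow> 'x set set" where
  "opens X \<equiv> {U. openin X U}"

abbreviation opens_in :: "'x topology \<Rightarrow> 'x set \<Rightarrow> 'x set set" where
  "opens_in X U \<equiv> {V. openin X V \<and> V \<subseteq> U}"

definition is_presheaf :: "'x topology \<Rightarrow> ('x, 'a) presheaf \<Rightarrow> bool" where
  "is_presheaf X F \<longleftrightarrow>
     sect F \<in> extensional (opens X) \<and>
     res F \<in> (\<Pi>\<^sub>E U\<in>opens X. \<Pi>\<^sub>E V\<in>opens_in X U. sect F U \<rightarrow>\<^sub>E sect F V) \<and>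
     (\<forall>U\<in>opens X. \<forall>s\<in>sect F U. res F U U s = s) \<and>
     (\<forall>U\<in>opens X. \<forall>V\<in>opens_in X U. \<forall>W\<in>opens_in X V. \<forall>s\<in>sect F U.
        res F V W (res F U V s) = res F U W s)"

text \<open>Covers are sets of open sets. Taking the empty cover of the empty set shows that
  \<open>sect F {}\<close> is a singleton.\<close>

definition is_sheaf :: "'x topology \<Rightarrow> ('x, 'a) presheaf \<Rightarrow> bool" where
  "is_sheaf X F \<longleftrightarrow>
     is_presheaf X F \<and>
     (\<forall>\<U> s. \<U> \<subseteq> opens X \<and> (\<forall>V\<in>\<U>. s V \<in> sect F V) \<and>
        (\<forall>V\<in>\<U>. \<forall>W\<in>\<U>. res F V (V \<inter> W) (s V) = res F W (V \<inter> W) (s W))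
        \<longrightarrow> (\<exists>!t. t \<in> sect F (\<Union>\<U>) \<and> (\<forall>V\<in>\<U>. res F (\<Union>\<U>) V t = s V)))"

text \<open>Morphisms are defined between sheaves with values in different types, because the inverse
  image of a sheaf has other values than the sheaf itself.\<close>

type_synonym ('x, 'a, 'b) sheaf_mor = "'x set \<Rightarrow> 'a \<Rightarrow> 'b"

definition sheaf_hom ::
    "'x topology \<Rightarrow> ('x, 'a) presheaf \<Rightarrow> ('x, 'b) presheaf \<Rightarrow> ('x, 'a, 'b) sheaf_mor set" where
  "sheaf_hom X F G =
     {\<phi> \<in> (\<Pi>\<^sub>E U\<in>opens X. sect F U \<rightarrow>\<^sub>E sect G U).
        \<forall>U\<in>opens X. \<forall>V\<in>opens_in X U. \<forall>s\<in>sect F U.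
          \<phi> V (res F U V s) = res G U V (\<phi> U s)}"

definition sheaf_id :: "'x topology \<Rightarrow> ('x, 'a) presheaf \<Rightarrow> ('x, 'a, 'a) sheaf_mor" where
  "sheaf_id X F = (\<lambda>U\<in>opens X. \<lambda>s\<in>sect F U. s)"

text \<open>The argument \<open>F\<close> of \<open>sheaf_comp\<close> is the source of \<open>\<phi>\<close>.\<close>

definition sheaf_comp ::
    "'x topology \<Rightarrow> ('x, 'a) presheaf \<Rightarrow> ('x, 'b, 'c) sheaf_mor \<Rightarrow> ('x, 'a, 'b) sheaf_mor \<Rightarrow>
     ('x, 'a, 'c) sheaf_mor" where
  "sheaf_comp X F \<psi> \<phi> = (\<lambda>U\<in>opens X. \<lambda>s\<in>sect F U. \<psi> U (\<phi> U s))"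

definition sheaf_cat :: "'x topology \<Rightarrow> (('x, 'a) presheaf, ('x, 'a, 'a) sheaf_mor) cat" where
  "sheaf_cat X =
     \<lparr>cobj = {F. is_sheaf X F},
      chom = sheaf_hom X,
      cid = sheaf_id X,
      ccomp = (\<lambda>F G H \<psi> \<phi>. sheaf_comp X F \<psi> \<phi>)\<rparr>"


section \<open>Inverse images\<close>

text \<open>The germ at \<open>x\<close> of a section \<open>s\<close> over \<open>U\<close>, as an equivalence class of pairs (open
  neighbourhood of \<open>x\<close>, section over it).\<close>

type_synonym ('x, 'a) germ = "('x set \<times> 'a) set"

definition germ ::
    "'x topology \<Rightarrow> ('x, 'a) presheaf \<Rightarrow> 'x \<Rightarrow> 'x set \<Rightarrow> 'a \<Rightarrow> ('x, 'a) germ" where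
  "germ X F x U s =
     {(V, t). openin X V \<and> x \<in> V \<and> t \<in> sect F V \<and>
        (\<exists>W. openin X W \<and> x \<in> W \<and> W \<subseteq> U \<inter> V \<and> res F U W s = res F V W t)}"

text \<open>The union is over representatives, on all of which the value is the same.\<close>

definition stalk_map ::
    "'x topology \<Rightarrow> ('x, 'b) presheaf \<Rightarrow> ('x, 'a, 'b) sheaf_mor \<Rightarrow> 'x \<Rightarrow>
     ('x, 'a) germ \<Rightarrow> ('x, 'b) germ" where
  "stalk_map X G \<phi> x g = (\<Union>(U, s)\<in>g. germ X G x U (\<phi> U s))"

text \<open>The inverse image of a sheaf \<open>F\<close> on \<open>Y\<close> along \<open>f : X \<rightarrow> Y\<close> is the sheaf of continuous sections
  of the pullback along \<open>f\<close> of the etale space of \<open>F\<close>: a section over \<open>U\<close> assigns to \<open>x \<in> U\<close> an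
  element of the stalk of \<open>F\<close> at \<open>f x\<close>, and it is given locally by the germs of a section of \<open>F\<close>.\<close>

definition pull_sect ::
    "'x topology \<Rightarrow> 'y topology \<Rightarrow> ('x \<Rightarrow> 'y) \<Rightarrow> ('y, 'a) presheaf \<Rightarrow> 'x set \<Rightarrow>
     ('x \<Rightarrow> ('y, 'a) germ) set" where
  "pull_sect X Y f F U =
     {s \<in> extensional U. \<forall>x\<in>U. \<exists>W V t.
        openin X W \<and> x \<in> W \<and> W \<subseteq> U \<and> openin Y V \<and> f ` W \<subseteq> V \<and> t \<in> sect F V \<and>
        (\<forall>w\<in>W. s w = germ Y F (f w) V t)}"

definition pull ::
    "'x topology \<Rightarrow> 'y topology \<Rightarrow> ('x \<Rightarrow> 'y) \<Rightarrow> ('y, 'a) presheaf \<Rightarrow>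
     ('x, 'x \<Rightarrow> ('y, 'a) germ) presheaf" where
  "pull X Y f F =
     \<lparr>sect = (\<lambda>U\<in>opens X. pull_sect X Y f F U),
      res = (\<lambda>U\<in>opens X. \<lambda>V\<in>opens_in X U. \<lambda>s\<in>pull_sect X Y f F U. restrict s V)\<rparr>"

text \<open>The inverse image of a morphism \<open>\<phi> : F \<rightarrow> G\<close> of sheaves on \<open>Y\<close>.\<close>

definition pull_map ::
    "'x topology \<Rightarrow> 'y topology \<Rightarrow> ('x \<Rightarrow> 'y) \<Rightarrow> ('y, 'a) presheaf \<Rightarrow> ('y, 'b) presheaf \<Rightarrow>
     ('y, 'a, 'b) sheaf_mor \<Rightarrow> ('x, 'x \<Rightarrow> ('y, 'a) germ, 'x \<Rightarrow> ('y, 'b) germ) sheaf_mor" where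
  "pull_map X Y f F G \<phi> =
     (\<lambda>U\<in>opens X. \<lambda>s\<in>sect (pull X Y f F) U. \<lambda>x\<in>U. stalk_map Y G \<phi> (f x) (s x))"

text \<open>The canonical isomorphism from \<open>F\<close> to its inverse image along the identity of \<open>X\<close>.\<close>

definition pull_id_iso ::
    "'x topology \<Rightarrow> ('x, 'a) presheaf \<Rightarrow> ('x, 'a, 'x \<Rightarrow> ('x, 'a) germ) sheaf_mor" where
  "pull_id_iso X F = (\<lambda>U\<in>opens X. \<lambda>s\<in>sect F U. \<lambda>x\<in>U. germ X F x U s)"

text \<open>For \<open>g : X \<rightarrow> Y\<close>, \<open>f : Y \<rightarrow> Z\<close> and \<open>F\<close> on \<open>Z\<close>, the canonical isomorphism from \<open>g\<^sup>* f\<^sup>* F\<close> to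
  \<open>(f g)\<^sup>* F\<close>. On stalks at \<open>x\<close> it takes the germ at \<open>g x\<close> of a section \<open>\<sigma>\<close> of \<open>f\<^sup>* F\<close> to the value
  \<open>\<sigma> (g x)\<close>, which is an element of the stalk of \<open>F\<close> at \<open>f (g x)\<close>; the union is again over
  representatives.\<close>

definition pull_comp_iso ::
    "'x topology \<Rightarrow> 'y topology \<Rightarrow> 'z topology \<Rightarrow> ('x \<Rightarrow> 'y) \<Rightarrow> ('y \<Rightarrow> 'z) \<Rightarrow> ('z, 'a) presheaf \<Rightarrow>
     ('x, 'x \<Rightarrow> ('y, 'y \<Rightarrow> ('z, 'a) germ) germ, 'x \<Rightarrow> ('z, 'a) germ) sheaf_mor" where
  "pull_comp_iso X Y Z g f F =
     (\<lambda>U\<in>opens X. \<lambda>s\<in>sect (pull X Y g (pull Y Z f F)) U. \<lambda>x\<in>U. \<Union>(V, \<sigma>)\<in>s x. \<sigma> (g x))"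


section \<open>Sheaves on simplicial spaces\<close>

text \<open>For \<open>\<alpha> : [p] \<rightarrow> [q]\<close> the map \<open>X\<^sub>q \<rightarrow> X\<^sub>p\<close> is \<open>fmap X q p \<alpha>\<close>, as \<open>X\<close> is a functor on the opposite
  of the simplex category.\<close>

record ('x, 'a) ssheaf =
  level :: "nat \<Rightarrow> ('x, 'a) presheaf"
  strmap :: "nat \<Rightarrow> nat \<Rightarrow> (nat \<Rightarrow> nat) \<Rightarrow> ('x, 'x \<Rightarrow> ('x, 'a) germ, 'a) sheaf_mor"

abbreviation spull ::
    "'x simplicial_space \<Rightarrow> nat \<Rightarrow> nat \<Rightarrow> (nat \<Rightarrow> nat) \<Rightarrow> ('x, 'a) presheaf \<Rightarrow>
     ('x, 'x \<Rightarrow> ('x, 'a) germ) presheaf" where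
  "spull X p q \<alpha> F \<equiv> pull (fobj X q) (fobj X p) (fmap X q p \<alpha>) F"

abbreviation spull_map ::
    "'x simplicial_space \<Rightarrow> nat \<Rightarrow> nat \<Rightarrow> (nat \<Rightarrow> nat) \<Rightarrow> ('x, 'a) presheaf \<Rightarrow> ('x, 'b) presheaf \<Rightarrow>
     ('x, 'a, 'b) sheaf_mor \<Rightarrow> ('x, 'x \<Rightarrow> ('x, 'a) germ, 'x \<Rightarrow> ('x, 'b) germ) sheaf_mor" where
  "spull_map X p q \<alpha> F G \<phi> \<equiv> pull_map (fobj X q) (fobj X p) (fmap X q p \<alpha>) F G \<phi>"

text \<open>The two functoriality conditions, with the canonical isomorphisms made explicit.\<close>

definition is_ssheaf :: "'x simplicial_space \<Rightarrow> ('x, 'a) ssheaf \<Rightarrow> bool" where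
  "is_ssheaf X F \<longleftrightarrow>
     (\<forall>p. is_sheaf (fobj X p) (level F p)) \<and>
     (\<forall>p q. strmap F p q \<in>
        (\<Pi>\<^sub>E \<alpha>\<in>chom simplex_cat p q.
           sheaf_hom (fobj X q) (spull X p q \<alpha> (level F p)) (level F q))) \<and>
     (\<forall>p. sheaf_comp (fobj X p) (level F p)
            (strmap F p p (cid simplex_cat p)) (pull_id_iso (fobj X p) (level F p)) =
          sheaf_id (fobj X p) (level F p)) \<and>
     (\<forall>p q r. \<forall>\<alpha>\<in>chom simplex_cat p q. \<forall>\<beta>\<in>chom simplex_cat q r.
        sheaf_comp (fobj X r) (spull X q r \<beta> (spull X p q \<alpha> (level F p)))
          (strmap F p r (ccomp simplex_cat p q r \<beta> \<alpha>))
          (pull_comp_iso (fobj X r) (fobj X q) (fobj X p) (fmap X r q \<beta>) (fmap X q p \<alpha>) (level F p)) =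
        sheaf_comp (fobj X r) (spull X q r \<beta> (spull X p q \<alpha> (level F p)))
          (strmap F q r \<beta>)
          (spull_map X q r \<beta> (spull X p q \<alpha> (level F p)) (level F q) (strmap F p q \<alpha>)))"

definition ssheaf_hom ::
    "'x simplicial_space \<Rightarrow> ('x, 'a) ssheaf \<Rightarrow> ('x, 'a) ssheaf \<Rightarrow>
     (nat \<Rightarrow> ('x, 'a, 'a) sheaf_mor) set" where
  "ssheaf_hom X F G =
     {\<phi>. (\<forall>p. \<phi> p \<in> sheaf_hom (fobj X p) (level F p) (level G p)) \<and>
        (\<forall>p q. \<forall>\<alpha>\<in>chom simplex_cat p q.
           sheaf_comp (fobj X q) (spull X p q \<alpha> (level F p)) (\<phi> q) (strmap F p q \<alpha>) =
           sheaf_comp (fobj X q) (spull X p q \<alpha> (level F p)) (strmap G p q \<alpha>)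
             (spull_map X p q \<alpha> (level F p) (level G p) (\<phi> p)))}"

definition ssheaf_cat ::
    "'x simplicial_space \<Rightarrow> (('x, 'a) ssheaf, nat \<Rightarrow> ('x, 'a, 'a) sheaf_mor) cat" where
  "ssheaf_cat X =
     \<lparr>cobj = {F. is_ssheaf X F},
      chom = ssheaf_hom X,
      cid = (\<lambda>F p. sheaf_id (fobj X p) (level F p)),
      ccomp = (\<lambda>F G H \<psi> \<phi> p. sheaf_comp (fobj X p) (level F p) (\<psi> p) (\<phi> p))\<rparr>"


section \<open>Cosimplicial sheaves\<close>

type_synonym ('x, 'a) csheaf =
  "(nat, nat \<Rightarrow> nat, ('x, 'a) presheaf, ('x, 'a, 'a) sheaf_mor) fctr"

definition csheaf_cat ::
    "'x topology \<Rightarrow> (('x, 'a) csheaf, nat \<Rightarrow> ('x, 'a, 'a) sheaf_mor) cat" where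
  "csheaf_cat X = functor_cat simplex_cat (sheaf_cat X)"


section \<open>Consistency of the definitions\<close>

lemma category_simplex_cat: "category simplex_cat"
proof -
  have "compose {0..p} \<beta> \<alpha> \<in> chom simplex_cat p r"
    if "\<alpha> \<in> chom simplex_cat p q" "\<beta> \<in> chom simplex_cat q r" for p q r \<alpha> \<beta>
    using that by (auto simp: simplex_cat_def mono_on_def compose_def PiE_iff Pi_iff)
  moreover have "compose {0..p} \<gamma> (compose {0..p} \<beta> \<alpha>) = compose {0..p} (compose {0..q} \<gamma> \<beta>) \<alpha>"
    if "\<alpha> \<in> chom simplex_cat p q" for p q \<alpha> \<beta> and \<gamma> :: "nat \<Rightarrow> nat"
    using that by (auto simp: simplex_cat_def compose_def fun_eq_iff PiE_iff Pi_iff)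
  moreover have "compose {0..p} \<alpha> (\<lambda>i\<in>{0..p}. i) = \<alpha> \<and> compose {0..p} (\<lambda>i\<in>{0..q}. i) \<alpha> = \<alpha>"
    if "\<alpha> \<in> chom simplex_cat p q" for p q \<alpha>
    using that
    by (auto simp: simplex_cat_def compose_def fun_eq_iff PiE_iff Pi_iff extensional_def)
  moreover have "(\<lambda>i\<in>{0..p}. i) \<in> chom simplex_cat p p" for p
    by (auto simp: simplex_cat_def mono_on_def)
  moreover have "cobj simplex_cat = UNIV" "cid simplex_cat = (\<lambda>p. \<lambda>i\<in>{0..p}. i)"
    "ccomp simplex_cat = (\<lambda>p q r \<beta> \<alpha>. compose {0..p} \<beta> \<alpha>)"
    by (auto simp: simplex_cat_def)
  ultimately show ?thesis
    unfolding category_def by (simp only:) blast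
qed

lemma category_top_cat: "category (top_cat :: ('x topology, 'x \<Rightarrow> 'x) cat)"
proof -
  have "compose (topspace X) g f \<in> chom top_cat X Z"
    if "f \<in> chom top_cat X Y" "g \<in> chom top_cat Y Z" for X Y Z :: "'x topology" and f g
  proof -
    have "continuous_map X Z (g \<circ> f)"
      using that by (auto simp: top_cat_def intro: continuous_map_compose)
    then have "continuous_map X Z (compose (topspace X) g f)"
      by (rule continuous_map_eq) (auto simp: compose_def)
    then show ?thesis by (auto simp: top_cat_def compose_def)
  qed
  moreover have "(\<lambda>x\<in>topspace X. x) \<in> chom top_cat X X" for X :: "'x topology"
    by (auto simp: top_cat_def intro: continuous_map_eq[OF continuous_map_id])
  moreover have "compose (topspace X) h (compose (topspace X) g f) =
      compose (topspace X) (compose (topspace Y) h g) f"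
    if "f \<in> chom top_cat X Y" for X Y :: "'x topology" and f :: "'x \<Rightarrow> 'x" and g h :: "'x \<Rightarrow> 'x"
    using that by (auto simp: top_cat_def compose_def fun_eq_iff continuous_map_def Pi_iff)
  moreover have "compose (topspace X) f (\<lambda>x\<in>topspace X. x) = f \<and>
      compose (topspace X) (\<lambda>x\<in>topspace Y. x) f = f" if "f \<in> chom top_cat X Y" for X Y :: "'x topology" and f
    using that
    by (auto simp: top_cat_def compose_def fun_eq_iff continuous_map_def Pi_iff extensional_def)
  moreover have "cobj (top_cat :: ('x topology, _) cat) = UNIV"
    "cid (top_cat :: ('x topology, _) cat) = (\<lambda>X. \<lambda>x\<in>topspace X. x)"
    "ccomp (top_cat :: ('x topology, _) cat) = (\<lambda>X Y Z g f. compose (topspace X) g f)"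
    by (auto simp: top_cat_def)
  ultimately show ?thesis
    unfolding category_def by (simp only:) blast
qed

lemma is_simplicial_space_constant: "is_simplicial_space (constant_simplicial_space X)"
proof -
  let ?i = "\<lambda>x\<in>topspace X. x"
  have obj: "cobj simplex_cat = UNIV" "cobj top_cat = UNIV" "cid top_cat X = ?i"
    "ccomp top_cat X X X ?i ?i = ?i"
    by (auto simp: simplex_cat_def top_cat_def compose_def)
  have i: "?i \<in> chom top_cat X X"
    by (auto simp: top_cat_def intro: continuous_map_eq[OF continuous_map_id])
  have "\<forall>p. cid simplex_cat p \<in> chom simplex_cat p p"
    using category_simplex_cat unfolding category_def obj by simp
  moreover have "\<forall>p q r. \<forall>\<alpha>\<in>chom simplex_cat p q. \<forall>\<beta>\<in>chom simplex_cat q r.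
      ccomp simplex_cat p q r \<beta> \<alpha> \<in> chom simplex_cat p r"
    using category_simplex_cat unfolding category_def obj by simp
  ultimately show ?thesis
    using i
    by (simp add: is_simplicial_space_def constant_simplicial_space_def is_functor_def
        const_functor_def op_cat_def obj)
qed

lemma presheaf_res:
  assumes "is_presheaf X F" "openin X U" "openin X V" "V \<subseteq> U" "s \<in> sect F U"
  shows "res F U V s \<in> sect F V"
    and "openin X W \<Longrightarrow> W \<subseteq> V \<Longrightarrow> res F V W (res F U V s) = res F U W s"
  using assms by (auto simp: is_presheaf_def PiE_iff Pi_iff)

lemma germ_eq_iff:
  assumes F: "is_presheaf X F" and U: "openin X U" "x \<in> U" "s \<in> sect F U"
    and V: "openin X V" "x \<in> V" "t \<in> sect F V"
  shows "germ X F x U s = germ X F x V t \<longleftrightarrow>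
    (\<exists>W. openin X W \<and> x \<in> W \<and> W \<subseteq> U \<inter> V \<and> res F U W s = res F V W t)"
proof
  assume "germ X F x U s = germ X F x V t"
  moreover have "(V, t) \<in> germ X F x V t" using V by (auto simp: germ_def)
  ultimately have "(V, t) \<in> germ X F x U s" by simp
  then show "\<exists>W. openin X W \<and> x \<in> W \<and> W \<subseteq> U \<inter> V \<and> res F U W s = res F V W t"
    by (simp add: germ_def)
next
  have *: "germ X F x V t \<subseteq> germ X F x U s"
    if U: "openin X U" "x \<in> U" "s \<in> sect F U" and V: "openin X V" "x \<in> V" "t \<in> sect F V"
      and W: "openin X W" "x \<in> W" "W \<subseteq> U \<inter> V" "res F U W s = res F V W t"
    for U V W s t
  proof clarify
    fix V' t' assume "(V', t') \<in> germ X F x V t"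
    then obtain W' where W': "openin X V'" "x \<in> V'" "t' \<in> sect F V'" "openin X W'" "x \<in> W'"
      "W' \<subseteq> V \<inter> V'" "res F V W' t = res F V' W' t'" by (auto simp: germ_def)
    let ?W = "W \<inter> W'"
    have "openin X ?W" using W(1) W'(4) by auto
    then have "res F W ?W (res F U W s) = res F U ?W s" "res F W ?W (res F V W t) = res F V ?W t"
      "res F W' ?W (res F V W' t) = res F V ?W t" "res F W' ?W (res F V' W' t') = res F V' ?W t'"
      using U V W(1,2,3) W'(1-6) by (intro presheaf_res(2)[OF F]; auto)+
    then have "res F U ?W s = res F V' ?W t'" using W(4) W'(7) by simp
    then show "(V', t') \<in> germ X F x U s"
      using W W' \<open>openin X ?W\<close> unfolding germ_def by blast
  qed
  assume "\<exists>W. openin X W \<and> x \<in> W \<and> W \<subseteq> U \<inter> V \<and> res F U W s = res F V W t"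
  then obtain W where "openin X W" "x \<in> W" "W \<subseteq> U \<inter> V" "res F U W s = res F V W t" by blast
  then show "germ X F x U s = germ X F x V t"
    using *[of U s V t W] *[of V t U s W] U V by auto
qed

lemma germ_res:
  assumes "is_presheaf X F" "openin X U" "openin X V" "V \<subseteq> U" "s \<in> sect F U" "x \<in> V"
  shows "germ X F x V (res F U V s) = germ X F x U s"
  using presheaf_res[OF assms(1-5)] assms by (subst germ_eq_iff) (auto intro!: exI[of _ V])

lemma germ_eqD:
  assumes "is_presheaf X F" "(V, t) \<in> germ X F x U s" "openin X U" "x \<in> U" "s \<in> sect F U"
  shows "germ X F x V t = germ X F x U s"
proof -
  have "openin X V" "x \<in> V" "t \<in> sect F V"
    "\<exists>W. openin X W \<and> x \<in> W \<and> W \<subseteq> U \<inter> V \<and> res F U W s = res F V W t"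
    using assms(2) by (auto simp: germ_def)
  then show ?thesis using germ_eq_iff[OF assms(1,3,4,5), of V t] by auto
qed

lemma sheaf_locality:
  assumes F: "is_sheaf X F" and U: "openin X U" "s \<in> sect F U" "t \<in> sect F U"
    and eq: "\<And>x. x \<in> U \<Longrightarrow> germ X F x U s = germ X F x U t"
  shows "s = t"
proof -
  have P: "is_presheaf X F" using F by (simp add: is_sheaf_def)
  define \<U> where "\<U> = {W. openin X W \<and> W \<subseteq> U \<and> res F U W s = res F U W t}"
  have "\<exists>W\<in>\<U>. x \<in> W" if "x \<in> U" for x
    using eq[OF that] germ_eq_iff[OF P U(1) that U(2) U(1) that U(3)] by (auto simp: \<U>_def)
  then have cover: "\<Union>\<U> = U" by (auto simp: \<U>_def)
  have "\<exists>!r. r \<in> sect F (\<Union>\<U>) \<and> (\<forall>V\<in>\<U>. res F (\<Union>\<U>) V r = res F U V s)"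
  proof -
    have "\<forall>V\<in>\<U>. res F U V s \<in> sect F V"
      using presheaf_res(1)[OF P U(1)] U by (auto simp: \<U>_def)
    moreover have "\<forall>V\<in>\<U>. \<forall>W\<in>\<U>. res F V (V \<inter> W) (res F U V s) = res F W (V \<inter> W) (res F U W s)"
    proof (intro ballI)
      fix V W assume "V \<in> \<U>" "W \<in> \<U>"
      then have "openin X V" "V \<subseteq> U" "openin X W" "W \<subseteq> U" by (auto simp: \<U>_def)
      then show "res F V (V \<inter> W) (res F U V s) = res F W (V \<inter> W) (res F U W s)"
        using presheaf_res(2)[OF P U(1) _ _ U(2), of V "V \<inter> W"]
          presheaf_res(2)[OF P U(1) _ _ U(2), of W "V \<inter> W"]
          openin_Int[of X V W] by auto
    qed
    moreover have "\<U> \<subseteq> opens X" by (auto simp: \<U>_def)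
    ultimately show ?thesis
      using F unfolding is_sheaf_def by (elim conjE allE[of _ \<U>] allE[of _ "\<lambda>V. res F U V s"]) blast
  qed
  moreover have "\<forall>V\<in>\<U>. res F U V t = res F U V s" by (auto simp: \<U>_def)
  ultimately show ?thesis using U cover by auto
qed

lemma sheaf_glue_germs:
  assumes F: "is_sheaf X F" and U: "openin X U"
    and loc: "\<And>x. x \<in> U \<Longrightarrow> \<exists>W t. openin X W \<and> x \<in> W \<and> W \<subseteq> U \<and> t \<in> sect F W \<and>
        (\<forall>w\<in>W. \<sigma> w = germ X F w W t)"
  shows "\<exists>t\<in>sect F U. \<forall>x\<in>U. \<sigma> x = germ X F x U t"
proof -
  have P: "is_presheaf X F" using F by (simp add: is_sheaf_def)
  define \<U> where "\<U> = {W. openin X W \<and> W \<subseteq> U \<and> (\<exists>t\<in>sect F W. \<forall>w\<in>W. \<sigma> w = germ X F w W t)}"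
  have "\<exists>W\<in>\<U>. x \<in> W" if "x \<in> U" for x
    using loc[OF that] unfolding \<U>_def by (elim exE conjE) (rule bexI, assumption, auto)
  then have "\<Union>\<U> = U" by (auto simp: \<U>_def)
  have "\<forall>W\<in>\<U>. \<exists>t. t \<in> sect F W \<and> (\<forall>w\<in>W. \<sigma> w = germ X F w W t)" by (auto simp: \<U>_def)
  then obtain s where s: "\<And>W. W \<in> \<U> \<Longrightarrow> s W \<in> sect F W"
    "\<And>W w. W \<in> \<U> \<Longrightarrow> w \<in> W \<Longrightarrow> \<sigma> w = germ X F w W (s W)" by metis
  have o: "openin X W" if "W \<in> \<U>" for W using that by (auto simp: \<U>_def)
  have "res F V (V \<inter> W) (s V) = res F W (V \<inter> W) (s W)" if "V \<in> \<U>" "W \<in> \<U>" for V W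
  proof (rule sheaf_locality[OF F])
    show oVW: "openin X (V \<inter> W)" using o that by auto
    show "res F V (V \<inter> W) (s V) \<in> sect F (V \<inter> W)" "res F W (V \<inter> W) (s W) \<in> sect F (V \<inter> W)"
      using presheaf_res(1)[OF P _ oVW] o that s by auto
    fix x assume "x \<in> V \<inter> W"
    then show "germ X F x (V \<inter> W) (res F V (V \<inter> W) (s V)) =
        germ X F x (V \<inter> W) (res F W (V \<inter> W) (s W))"
      using o that s oVW by (simp add: germ_res[OF P]) (metis)
  qed
  then have "\<exists>!t. t \<in> sect F (\<Union>\<U>) \<and> (\<forall>V\<in>\<U>. res F (\<Union>\<U>) V t = s V)"
    using F s o unfolding is_sheaf_def by (elim conjE allE[of _ \<U>] allE[of _ s]) blast
  then obtain t where t: "t \<in> sect F U" "\<And>V. V \<in> \<U> \<Longrightarrow> res F U V t = s V"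
    unfolding \<open>\<Union>\<U> = U\<close> by blast
  have "\<sigma> x = germ X F x U t" if x: "x \<in> U" for x
  proof -
    obtain V where V: "V \<in> \<U>" "x \<in> V" using x \<open>\<Union>\<U> = U\<close> by blast
    then have "V \<subseteq> U" by (auto simp: \<U>_def)
    have "\<sigma> x = germ X F x V (s V)" using s V by auto
    also have "\<dots> = germ X F x U t" using germ_res[OF P U o[OF V(1)] \<open>V \<subseteq> U\<close> t(1) V(2)] t V by simp
    finally show ?thesis .
  qed
  then show ?thesis using t by blast
qed

lemma pull_simps [simp]:
  "openin X U \<Longrightarrow> sect (pull X Y f F) U = pull_sect X Y f F U"
  "openin X U \<Longrightarrow> openin X V \<Longrightarrow> V \<subseteq> U \<Longrightarrow> s \<in> pull_sect X Y f F U \<Longrightarrow>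
     res (pull X Y f F) U V s = restrict s V"
  by (auto simp: pull_def)

lemma pull_sect_restrict:
  assumes "s \<in> pull_sect X Y f F U" "openin X V" "V \<subseteq> U"
  shows "restrict s V \<in> pull_sect X Y f F V"
  unfolding pull_sect_def
proof (intro CollectI conjI ballI)
  fix x assume "x \<in> V"
  then obtain W V' t where "openin X W" "x \<in> W" "openin Y V'" "f ` W \<subseteq> V'" "t \<in> sect F V'"
    "\<forall>w\<in>W. s w = germ Y F (f w) V' t"
    using assms unfolding pull_sect_def by blast
  then show "\<exists>W V' t. openin X W \<and> x \<in> W \<and> W \<subseteq> V \<and> openin Y V' \<and> f ` W \<subseteq> V' \<and>
      t \<in> sect F V' \<and> (\<forall>w\<in>W. restrict s V w = germ Y F (f w) V' t)"
    using assms \<open>x \<in> V\<close> by (intro exI[of _ "W \<inter> V"] exI[of _ V'] exI[of _ t]) auto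
qed auto

lemma is_sheaf_pull: "is_sheaf X (pull X Y f F)"
proof -
  have presheaf: "is_presheaf X (pull X Y f F)"
  proof -
    have "res (pull X Y f F) \<in> (\<Pi>\<^sub>E U\<in>opens X. \<Pi>\<^sub>E V\<in>opens_in X U.
        sect (pull X Y f F) U \<rightarrow>\<^sub>E sect (pull X Y f F) V)"
      by (auto simp: pull_def pull_sect_restrict)
    moreover have "restrict s U = s" if "s \<in> pull_sect X Y f F U" for U s
      using that by (auto simp: pull_sect_def extensional_restrict)
    ultimately show ?thesis
      by (auto simp: is_presheaf_def pull_sect_restrict Int_absorb1) (auto simp: pull_def)
  qed
  have glue: "\<exists>!t. t \<in> sect (pull X Y f F) (\<Union>\<U>) \<and>
      (\<forall>V\<in>\<U>. res (pull X Y f F) (\<Union>\<U>) V t = s V)"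
    if U: "\<U> \<subseteq> opens X" and s: "\<forall>V\<in>\<U>. s V \<in> sect (pull X Y f F) V"
      and eq: "\<forall>V\<in>\<U>. \<forall>W\<in>\<U>. res (pull X Y f F) V (V \<inter> W) (s V) = res (pull X Y f F) W (V \<inter> W) (s W)"
    for \<U> s
  proof -
    have oU: "openin X (\<Union>\<U>)" and o: "\<And>V. V \<in> \<U> \<Longrightarrow> openin X V" using U by auto
    have s': "s V \<in> pull_sect X Y f F V" if "V \<in> \<U>" for V using s o that by auto
    have eq': "s V x = s W x" if "V \<in> \<U>" "W \<in> \<U>" "x \<in> V" "x \<in> W" for V W x
    proof -
      have "restrict (s V) (V \<inter> W) = restrict (s W) (V \<inter> W)"
        using eq o that s' by (metis Int_lower1 Int_lower2 openin_Int pull_simps(2))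
      then show ?thesis using that by (metis IntI restrict_apply')
    qed
    define t where "t = (\<lambda>x\<in>\<Union>\<U>. s (SOME V. V \<in> \<U> \<and> x \<in> V) x)"
    have t: "t x = s V x" if "V \<in> \<U>" "x \<in> V" for V x
    proof -
      have "(SOME V. V \<in> \<U> \<and> x \<in> V) \<in> \<U> \<and> x \<in> (SOME V. V \<in> \<U> \<and> x \<in> V)"
        using that by (intro someI[of "\<lambda>V. V \<in> \<U> \<and> x \<in> V" V]) auto
      moreover have "t x = s (SOME V. V \<in> \<U> \<and> x \<in> V) x"
        using that by (auto simp: t_def)
      ultimately show ?thesis
        using that eq'[of "SOME V. V \<in> \<U> \<and> x \<in> V" V x] by simp
    qed
    have tP: "t \<in> pull_sect X Y f F (\<Union>\<U>)"
      unfolding pull_sect_def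
    proof (intro CollectI conjI ballI)
      fix x assume "x \<in> \<Union>\<U>"
      then obtain V where V: "V \<in> \<U>" "x \<in> V" by blast
      then obtain W V' r where W: "openin X W" "x \<in> W" "W \<subseteq> V" "openin Y V'" "f ` W \<subseteq> V'"
        "r \<in> sect F V'" "\<forall>w\<in>W. s V w = germ Y F (f w) V' r"
        using s'[OF V(1)] unfolding pull_sect_def by blast
      moreover have "\<forall>w\<in>W. t w = germ Y F (f w) V' r" using W t V by (metis subsetD)
      ultimately show "\<exists>W V' r. openin X W \<and> x \<in> W \<and> W \<subseteq> \<Union>\<U> \<and> openin Y V' \<and> f ` W \<subseteq> V' \<and>
          r \<in> sect F V' \<and> (\<forall>w\<in>W. t w = germ Y F (f w) V' r)"
        using V by blast
    qed (auto simp: t_def)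
    have ext: "s V \<in> extensional V" if "V \<in> \<U>" for V using s'[OF that] by (simp add: pull_sect_def)
    have R: "res (pull X Y f F) (\<Union>\<U>) V r = restrict r V"
      if "V \<in> \<U>" "r \<in> pull_sect X Y f F (\<Union>\<U>)" for V r
      using that oU o by (intro pull_simps) auto
    show ?thesis
    proof (rule ex1I[of _ t], intro conjI ballI)
      show "t \<in> sect (pull X Y f F) (\<Union>\<U>)" using tP oU by simp
      fix V assume V: "V \<in> \<U>"
      have "restrict t V = s V"
        using t[OF V] ext[OF V] by (auto simp: fun_eq_iff restrict_def extensional_def)
      then show "res (pull X Y f F) (\<Union>\<U>) V t = s V" using R[OF V tP] by simp
    next
      fix r assume r: "r \<in> sect (pull X Y f F) (\<Union>\<U>) \<and> (\<forall>V\<in>\<U>. res (pull X Y f F) (\<Union>\<U>) V r = s V)"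
      then have rP: "r \<in> pull_sect X Y f F (\<Union>\<U>)" using oU by simp
      have "r x = t x" if x: "x \<in> \<Union>\<U>" for x
      proof -
        obtain V where V: "V \<in> \<U>" "x \<in> V" using x by blast
        then have "restrict r V = s V" using r R[OF V(1) rP] by auto
        then show ?thesis using t[OF V] V by (metis restrict_apply')
      qed
      moreover have "r \<in> extensional (\<Union>\<U>)" "t \<in> extensional (\<Union>\<U>)"
        using rP tP by (auto simp: pull_sect_def)
      ultimately show "r = t" by (rule extensionalityI[rotated 2])
    qed
  qed
  show ?thesis
    unfolding is_sheaf_def using presheaf
    by (intro conjI allI impI) (assumption, elim conjE, rule glue)
qed

lemma pull_id_iso_hom:
  assumes F: "is_sheaf X F"
  shows "pull_id_iso X F \<in> sheaf_hom X F (pull X X (\<lambda>x\<in>topspace X. x) F)"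
proof -
  let ?P = "pull_sect X X (\<lambda>x\<in>topspace X. x) F"
  have P: "is_presheaf X F" using F by (simp add: is_sheaf_def)
  have *: "(\<lambda>x\<in>U. germ X F x U s) \<in> ?P U" if "openin X U" "s \<in> sect F U" for U s
    using that openin_subset[OF that(1)]
    by (auto simp: pull_sect_def intro!: exI[of _ U] bexI[of _ s] exI[of _ s])
  show ?thesis
    unfolding sheaf_hom_def
  proof (intro CollectI conjI ballI)
    show "pull_id_iso X F \<in> (\<Pi>\<^sub>E U\<in>opens X. sect F U \<rightarrow>\<^sub>E sect (pull X X (\<lambda>x\<in>topspace X. x) F) U)"
      using * by (auto simp: pull_id_iso_def)
    fix U V s assume UV: "U \<in> opens X" "V \<in> opens_in X U" and s: "s \<in> sect F U"
    then show "pull_id_iso X F V (res F U V s) =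
        res (pull X X (\<lambda>x\<in>topspace X. x) F) U V (pull_id_iso X F U s)"
      using * presheaf_res(1)[OF P _ _ _ s, of V] germ_res[OF P _ _ _ s, of V]
      by (auto simp: pull_id_iso_def fun_eq_iff restrict_def)
  qed
qed

lemma pull_id_iso_bij:
  assumes F: "is_sheaf X F" and U: "openin X U"
  shows "bij_betw (pull_id_iso X F U) (sect F U) (sect (pull X X (\<lambda>x\<in>topspace X. x) F) U)"
  unfolding bij_betw_def
proof
  have P: "is_presheaf X F" using F by (simp add: is_sheaf_def)
  show "inj_on (pull_id_iso X F U) (sect F U)"
  proof (rule inj_onI)
    fix s t assume st: "s \<in> sect F U" "t \<in> sect F U" "pull_id_iso X F U s = pull_id_iso X F U t"
    then show "s = t"
      by (intro sheaf_locality[OF F U]) (auto simp: pull_id_iso_def U fun_eq_iff restrict_def split: if_splits)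
  qed
  show "pull_id_iso X F U ` sect F U = sect (pull X X (\<lambda>x\<in>topspace X. x) F) U"
  proof
    show "pull_id_iso X F U ` sect F U \<subseteq> sect (pull X X (\<lambda>x\<in>topspace X. x) F) U"
      using pull_id_iso_hom[OF F] U by (auto simp: sheaf_hom_def PiE_iff Pi_iff)
    show "sect (pull X X (\<lambda>x\<in>topspace X. x) F) U \<subseteq> pull_id_iso X F U ` sect F U"
    proof
      fix \<sigma> assume "\<sigma> \<in> sect (pull X X (\<lambda>x\<in>topspace X. x) F) U"
      then have \<sigma>: "\<sigma> \<in> pull_sect X X (\<lambda>x\<in>topspace X. x) F U" using U by simp
      have "\<exists>t\<in>sect F U. \<forall>x\<in>U. \<sigma> x = germ X F x U t"
      proof (rule sheaf_glue_germs[OF F U])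
        fix x assume "x \<in> U"
        then obtain W V t where W: "openin X W" "x \<in> W" "W \<subseteq> U" "openin X V"
          "(\<lambda>x\<in>topspace X. x) ` W \<subseteq> V" "t \<in> sect F V"
          "\<forall>w\<in>W. \<sigma> w = germ X F ((\<lambda>x\<in>topspace X. x) w) V t"
          using \<sigma> unfolding pull_sect_def by blast
        have i: "(\<lambda>x\<in>topspace X. x) w = w" if "w \<in> W" for w
          using openin_subset[OF W(1)] that by auto
        then have "W \<subseteq> V" using W(5) by force
        then have "\<forall>w\<in>W. \<sigma> w = germ X F w W (res F V W t)"
          using W(7) i germ_res[OF P W(4,1) _ W(6)] by auto
        moreover have "res F V W t \<in> sect F W" by (rule presheaf_res(1)[OF P W(4,1) \<open>W \<subseteq> V\<close> W(6)])
        ultimately show "\<exists>W t. openin X W \<and> x \<in> W \<and> W \<subseteq> U \<and> t \<in> sect F W \<and>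
            (\<forall>w\<in>W. \<sigma> w = germ X F w W t)" using W by blast
      qed
      then obtain t where t: "t \<in> sect F U" "\<forall>x\<in>U. \<sigma> x = germ X F x U t" by blast
      have "\<sigma> = pull_id_iso X F U t"
        using t \<sigma> U by (auto simp: pull_id_iso_def fun_eq_iff pull_sect_def extensional_def)
      then show "\<sigma> \<in> pull_id_iso X F U ` sect F U" using t by blast
    qed
  qed
qed

lemma germ_self: "openin X U \<Longrightarrow> x \<in> U \<Longrightarrow> s \<in> sect F U \<Longrightarrow> (U, s) \<in> germ X F x U s"
  by (auto simp: germ_def)

lemma stalk_map_germ:
  assumes F: "is_presheaf X F" and G: "is_presheaf X G" and \<phi>: "\<phi> \<in> sheaf_hom X F G"
    and U: "openin X U" "x \<in> U" "s \<in> sect F U"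
  shows "stalk_map X G \<phi> x (germ X F x U s) = germ X G x U (\<phi> U s)"
proof -
  have sect: "\<phi> V t \<in> sect G V" if "openin X V" "t \<in> sect F V" for V t
    using \<phi> that by (auto simp: sheaf_hom_def PiE_iff Pi_iff)
  have nat: "\<phi> W (res F V W t) = res G V W (\<phi> V t)"
    if "openin X V" "t \<in> sect F V" "openin X W" "W \<subseteq> V" for V W t
    using \<phi> that by (auto simp: sheaf_hom_def)
  have "germ X G x V (\<phi> V t) = germ X G x U (\<phi> U s)" if Vt: "(V, t) \<in> germ X F x U s" for V t
  proof -
    obtain W where "openin X V" "x \<in> V" "t \<in> sect F V" "openin X W" "x \<in> W" "W \<subseteq> U \<inter> V"
      "res F U W s = res F V W t"
      using Vt by (auto simp: germ_def)
    moreover from this have "res G U W (\<phi> U s) = res G V W (\<phi> V t)"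
      using nat U by (metis le_inf_iff)
    ultimately show ?thesis
      using germ_eq_iff[OF G U(1,2) sect[OF U(1,3)], of V "\<phi> V t"] sect by auto
  qed
  then show ?thesis
    using germ_self[OF U] unfolding stalk_map_def by blast
qed

lemma pull_comp_iso_germ:
  assumes U: "openin Y U" "y \<in> U" "\<sigma> \<in> pull_sect Y Z f F U"
  shows "(\<Union>(V, \<tau>)\<in>germ Y (pull Y Z f F) y U \<sigma>. \<tau> y) = \<sigma> y"
proof -
  have "\<tau> y = \<sigma> y" if Vt: "(V, \<tau>) \<in> germ Y (pull Y Z f F) y U \<sigma>" for V \<tau>
  proof -
    obtain W where W: "openin Y V" "\<tau> \<in> sect (pull Y Z f F) V" "openin Y W" "y \<in> W"
      "W \<subseteq> U \<inter> V" "res (pull Y Z f F) U W \<sigma> = res (pull Y Z f F) V W \<tau>"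
      using Vt by (auto simp: germ_def)
    then have "restrict \<sigma> W = restrict \<tau> W" using U by simp
    then show ?thesis using W by (metis restrict_apply')
  qed
  moreover have "(U, \<sigma>) \<in> germ Y (pull Y Z f F) y U \<sigma>" using U by (auto intro: germ_self)
  ultimately show ?thesis by blast
qed

end

(* Inverse image along the identity is naturally isomorphic to the identity, by sending a section to
   its family of germs. Precomposing a structure map (id)^* F^p -> F^q with this isomorphism gives a
   map F^p -> F^q. As the isomorphism is natural and inverse to the coherence (id)^* (id)^* = (id)^*,
   the functoriality conditions on both sides agree, and so do the compatibility conditions on a
   family of sheaf morphisms. The two categories are thus even isomorphic, by a functor that does
   not change morphisms. *)
theory Submission
  imports Defs
begin

section \<open>Categories: a criterion for equivalence, and functor categories\<close>

text \<open>The hom-sets, identities and compositions of \<open>D\<close> are literally those of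
  \<open>C\<close> along \<Phi>, so the category axioms carry over to \<open>D\<close>. The functors
  that use \<Phi> and its inverse on objects and leave morphisms alone are strictly inverse to each
  other, and identities serve as unit and counit.\<close>

lemma equivalent_categories_bij_objects:
  assumes C: "category C" and bij: "bij_betw \<Phi> (cobj D) (cobj C)"
    and hom: "\<And>a b. a \<in> cobj D \<Longrightarrow> b \<in> cobj D \<Longrightarrow> chom D a b = chom C (\<Phi> a) (\<Phi> b)"
    and ident: "\<And>a. a \<in> cobj D \<Longrightarrow> cid D a = cid C (\<Phi> a)"
    and comp: "\<And>a b c. a \<in> cobj D \<Longrightarrow> b \<in> cobj D \<Longrightarrow> c \<in> cobj D \<Longrightarrow>
      ccomp D a b c = ccomp C (\<Phi> a) (\<Phi> b) (\<Phi> c)"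
  shows "equivalent_categories C D"
proof -
  define \<Psi> where "\<Psi> = inv_into (cobj D) \<Phi>"
  have \<Phi>: "\<Phi> a \<in> cobj C" if "a \<in> cobj D" for a using bij_betwE[OF bij] that by blast
  have \<Psi>: "\<Psi> c \<in> cobj D" if "c \<in> cobj C" for c
    using bij_betwE[OF bij_betw_inv_into[OF bij]] that by (auto simp: \<Psi>_def)
  have \<Phi>\<Psi>: "\<Phi> (\<Psi> c) = c" if "c \<in> cobj C" for c
    using bij_betw_inv_into_right[OF bij that] by (simp add: \<Psi>_def)
  have \<Psi>\<Phi>: "\<Psi> (\<Phi> a) = a" if "a \<in> cobj D" for a
    using bij_betw_inv_into_left[OF bij that] by (simp add: \<Psi>_def)
  have idC: "cid C a \<in> chom C a a" if "a \<in> cobj C" for a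
    using C that by (simp add: category_def)
  have unitC: "ccomp C a a b f (cid C a) = f" "ccomp C a b b (cid C b) f = f"
    if "a \<in> cobj C" "b \<in> cobj C" "f \<in> chom C a b" for a b f
    using C that by (simp_all add: category_def)
  have D: "category D"
    using C unfolding category_def by (simp add: hom ident comp \<Phi>)
  have idD: "cid D a \<in> chom D a a" if "a \<in> cobj D" for a
    using D that by (simp add: category_def)
  have unitD: "ccomp D a a b f (cid D a) = f" "ccomp D a b b (cid D b) f = f"
    if "a \<in> cobj D" "b \<in> cobj D" "f \<in> chom D a b" for a b f
    using D that by (simp_all add: category_def)
  have compC: "ccomp C a b c g f \<in> chom C a c"
    if "a \<in> cobj C" "b \<in> cobj C" "c \<in> cobj C" "f \<in> chom C a b" "g \<in> chom C b c" for a b c f g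
    using C that unfolding category_def by blast
  define F where "F = \<lparr>fobj = (\<lambda>a\<in>cobj C. \<Psi> a),
    fmap = (\<lambda>a\<in>cobj C. \<lambda>b\<in>cobj C. \<lambda>f\<in>chom C a b. f)\<rparr>"
  define G where "G = \<lparr>fobj = (\<lambda>a\<in>cobj D. \<Phi> a),
    fmap = (\<lambda>a\<in>cobj D. \<lambda>b\<in>cobj D. \<lambda>f\<in>chom D a b. f)\<rparr>"
  have compD: "ccomp D a b c g f \<in> chom D a c"
    if "a \<in> cobj D" "b \<in> cobj D" "c \<in> cobj D" "f \<in> chom D a b" "g \<in> chom D b c" for a b c f g
    using D that unfolding category_def by blast
  have F: "is_functor C D F"
    by (auto simp: is_functor_def F_def \<Psi> hom ident comp \<Phi>\<Psi> idC compC)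
  have G: "is_functor D C G"
    using compD by (auto simp: is_functor_def G_def \<Phi> hom ident comp idC)
  \<comment> \<open>These are equalities of functors and not just isomorphisms, as both sides are
    \<open>undefined\<close> outside the same domains.\<close>
  have GF: "comp_functor C G F = id_functor C"
    by (auto simp: comp_functor_def id_functor_def F_def G_def \<Psi> hom \<Phi>\<Psi> restrict_def fun_eq_iff)
  have FG: "comp_functor D F G = id_functor D"
    by (auto simp: comp_functor_def id_functor_def F_def G_def \<Phi> hom \<Psi>\<Phi> restrict_def fun_eq_iff)
  have "nat_iso C C (id_functor C) (comp_functor C G F) (\<lambda>a\<in>cobj C. cid C a)"
    unfolding GF
    by (auto simp: nat_iso_def nat_trans_def iso_in_def id_functor_def idC unitC
        intro!: bexI[of _ "cid C _"])
  moreover have "nat_iso D D (comp_functor D F G) (id_functor D) (\<lambda>a\<in>cobj D. cid D a)"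
    unfolding FG
    by (auto simp: nat_iso_def nat_trans_def iso_in_def id_functor_def idD unitD
        intro!: bexI[of _ "cid D _"])
  ultimately show ?thesis
    unfolding equivalent_categories_def using C D F G by blast
qed

text \<open>Everything holds componentwise in \<open>D\<close>. Equality of components gives
  equality of transformations because these are extensional on \<open>cobj C\<close>.\<close>

lemma category_functor_cat:
  assumes C: "category C" and D: "category D"
  shows "category (functor_cat C D)"
proof -
  have id: "cid D a \<in> chom D a a" if "a \<in> cobj D" for a
    using D that by (simp add: category_def)
  have unit: "ccomp D a a b f (cid D a) = f" "ccomp D a b b (cid D b) f = f"
    if "a \<in> cobj D" "b \<in> cobj D" "f \<in> chom D a b" for a b f
    using D that by (simp_all add: category_def)
  have comp: "ccomp D a b c g f \<in> chom D a c"
    if "a \<in> cobj D" "b \<in> cobj D" "c \<in> cobj D" "f \<in> chom D a b" "g \<in> chom D b c" for a b c f g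
    using D that unfolding category_def by blast
  have assoc: "ccomp D a c d h (ccomp D a b c g f) = ccomp D a b d (ccomp D b c d h g) f"
    if "a \<in> cobj D" "b \<in> cobj D" "c \<in> cobj D" "d \<in> cobj D"
      "f \<in> chom D a b" "g \<in> chom D b c" "h \<in> chom D c d" for a b c d f g h
    using D that unfolding category_def by blast
  have obj: "fobj F a \<in> cobj D" if "is_functor C D F" "a \<in> cobj C" for F a
    using that by (auto simp: is_functor_def)
  have map: "fmap F a b f \<in> chom D (fobj F a) (fobj F b)"
    if "is_functor C D F" "a \<in> cobj C" "b \<in> cobj C" "f \<in> chom C a b" for F a b f
  proof -
    have "fmap F \<in> (\<Pi>\<^sub>E a\<in>cobj C. \<Pi>\<^sub>E b\<in>cobj C. chom C a b \<rightarrow>\<^sub>E chom D (fobj F a) (fobj F b))"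
      using that(1) by (simp add: is_functor_def)
    then show ?thesis using that by (meson PiE_mem)
  qed
  have app: "\<tau> a \<in> chom D (fobj F a) (fobj G a)" if "nat_trans C D F G \<tau>" "a \<in> cobj C" for F G \<tau> a
    using that by (auto simp: nat_trans_def)
  have sq: "ccomp D (fobj F a) (fobj F b) (fobj G b) (\<tau> b) (fmap F a b f) =
      ccomp D (fobj F a) (fobj G a) (fobj G b) (fmap G a b f) (\<tau> a)"
    if "nat_trans C D F G \<tau>" "a \<in> cobj C" "b \<in> cobj C" "f \<in> chom C a b" for F G \<tau> a b f
    using that by (auto simp: nat_trans_def)
  have ext: "\<tau> \<in> extensional (cobj C)" if "nat_trans C D F G \<tau>" for F G \<tau>
    using that by (simp add: nat_trans_def PiE_def)
  have ntid: "nat_trans C D F F (\<lambda>a\<in>cobj C. cid D (fobj F a))" if "is_functor C D F" for F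
    using that by (auto simp: nat_trans_def id unit obj map)
  have ntcomp: "nat_trans C D F H
      (\<lambda>a\<in>cobj C. ccomp D (fobj F a) (fobj G a) (fobj H a) (\<tau> a) (\<sigma> a))"
    if F: "is_functor C D F" and G: "is_functor C D G" and H: "is_functor C D H"
      and \<sigma>: "nat_trans C D F G \<sigma>" and \<tau>: "nat_trans C D G H \<tau>" for F G H \<sigma> \<tau>
    unfolding nat_trans_def
  proof (intro conjI ballI)
    show "(\<lambda>a\<in>cobj C. ccomp D (fobj F a) (fobj G a) (fobj H a) (\<tau> a) (\<sigma> a)) \<in>
        (\<Pi>\<^sub>E a\<in>cobj C. chom D (fobj F a) (fobj H a))"
      using F G H by (auto intro!: comp obj app[OF \<sigma>] app[OF \<tau>])
    fix a b f assume a: "a \<in> cobj C" and b: "b \<in> cobj C" and f: "f \<in> chom C a b"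
    let ?F = "fobj F" and ?G = "fobj G" and ?H = "fobj H"
    note o = obj[OF F a] obj[OF F b] obj[OF G a] obj[OF G b] obj[OF H a] obj[OF H b]
    note m = map[OF F a b f] map[OF G a b f] map[OF H a b f]
      app[OF \<sigma> a] app[OF \<sigma> b] app[OF \<tau> a] app[OF \<tau> b]
    \<comment> \<open>The naturality squares of \<sigma> and \<tau> are pasted side by side:
      associativity brings first the square of \<sigma> and then that of \<tau> into a form where it
      can be replaced.\<close>
    have "ccomp D (?F a) (?F b) (?H b) (ccomp D (?F b) (?G b) (?H b) (\<tau> b) (\<sigma> b)) (fmap F a b f) =
        ccomp D (?F a) (?G b) (?H b) (\<tau> b) (ccomp D (?F a) (?F b) (?G b) (\<sigma> b) (fmap F a b f))"
      using assoc[of "?F a" "?F b" "?G b" "?H b"] o m by simp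
    also have "\<dots> = ccomp D (?F a) (?G a) (?H b)
        (ccomp D (?G a) (?G b) (?H b) (\<tau> b) (fmap G a b f)) (\<sigma> a)"
      unfolding sq[OF \<sigma> a b f] using assoc[of "?F a" "?G a" "?G b" "?H b"] o m by simp
    also have "\<dots> = ccomp D (?F a) (?H a) (?H b) (fmap H a b f)
        (ccomp D (?F a) (?G a) (?H a) (\<tau> a) (\<sigma> a))"
      unfolding sq[OF \<tau> a b f] using assoc[of "?F a" "?G a" "?H a" "?H b"] o m by simp
    finally show "ccomp D (?F a) (?F b) (?H b)
        ((\<lambda>a\<in>cobj C. ccomp D (?F a) (?G a) (?H a) (\<tau> a) (\<sigma> a)) b) (fmap F a b f) =
      ccomp D (?F a) (?H a) (?H b) (fmap H a b f)
        ((\<lambda>a\<in>cobj C. ccomp D (?F a) (?G a) (?H a) (\<tau> a) (\<sigma> a)) a)"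
      using a b by simp
  qed
  have ntunit: "(\<lambda>a\<in>cobj C. ccomp D (fobj F a) (fobj F a) (fobj G a) (\<tau> a)
        ((\<lambda>a\<in>cobj C. cid D (fobj F a)) a)) = \<tau> \<and>
      (\<lambda>a\<in>cobj C. ccomp D (fobj F a) (fobj G a) (fobj G a)
        ((\<lambda>a\<in>cobj C. cid D (fobj G a)) a) (\<tau> a)) = \<tau>"
    if "is_functor C D F" "is_functor C D G" "nat_trans C D F G \<tau>" for F G \<tau>
    using that ext[OF that(3)]
    by (auto intro!: extensionalityI[of _ "cobj C"] simp: unit obj app)
  have ntassoc: "(\<lambda>a\<in>cobj C. ccomp D (fobj F a) (fobj H a) (fobj K a) (\<upsilon> a)
        ((\<lambda>a\<in>cobj C. ccomp D (fobj F a) (fobj G a) (fobj H a) (\<tau> a) (\<sigma> a)) a)) =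
      (\<lambda>a\<in>cobj C. ccomp D (fobj F a) (fobj G a) (fobj K a)
        ((\<lambda>a\<in>cobj C. ccomp D (fobj G a) (fobj H a) (fobj K a) (\<upsilon> a) (\<tau> a)) a) (\<sigma> a))"
    if "is_functor C D F" "is_functor C D G" "is_functor C D H" "is_functor C D K"
      "nat_trans C D F G \<sigma>" "nat_trans C D G H \<tau>" "nat_trans C D H K \<upsilon>" for F G H K \<sigma> \<tau> \<upsilon>
    using that by (auto intro!: restrict_ext assoc obj app)
  show ?thesis
    unfolding category_def functor_cat_def cat.simps mem_Collect_eq
    using ntid ntcomp ntunit ntassoc by blast
qed

section \<open>Morphisms of sheaves and the category they form\<close>

lemma sheaf_hom_mem:
  "\<phi> \<in> sheaf_hom X F G \<Longrightarrow> openin X U \<Longrightarrow> s \<in> sect F U \<Longrightarrow> \<phi> U s \<in> sect G U"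
  by (auto simp: sheaf_hom_def)

lemma sheaf_hom_res:
  "\<phi> \<in> sheaf_hom X F G \<Longrightarrow> openin X U \<Longrightarrow> openin X V \<Longrightarrow> V \<subseteq> U \<Longrightarrow> s \<in> sect F U \<Longrightarrow>
    \<phi> V (res F U V s) = res G U V (\<phi> U s)"
  by (simp add: sheaf_hom_def)

lemma sheaf_hom_eqI:
  assumes "\<phi> \<in> sheaf_hom X F G" "\<psi> \<in> sheaf_hom X F G"
    and "\<And>U s. openin X U \<Longrightarrow> s \<in> sect F U \<Longrightarrow> \<phi> U s = \<psi> U s"
  shows "\<phi> = \<psi>"
  by (rule PiE_ext[of _ "opens X" "\<lambda>U. sect F U \<rightarrow>\<^sub>E sect G U"])
    (use assms in \<open>auto simp: sheaf_hom_def intro!: PiE_ext[of _ "sect F _" "\<lambda>_. sect G _"]\<close>)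

lemma sheaf_comp_apply [simp]:
  "openin X U \<Longrightarrow> s \<in> sect F U \<Longrightarrow> sheaf_comp X F \<psi> \<phi> U s = \<psi> U (\<phi> U s)"
  by (simp add: sheaf_comp_def)

text \<open>Off the open sets and the sections of \<open>F\<close> both composites are
  \<open>undefined\<close>, so nothing need be known about the factors. Conditions on composites
  thereby become identities between sections, even when the two intermediate sheaves have values in
  different types.\<close>

lemma sheaf_comp_eq_iff:
  "sheaf_comp X F \<psi> \<phi> = sheaf_comp X F \<psi>' \<phi>' \<longleftrightarrow>
    (\<forall>U\<in>opens X. \<forall>s\<in>sect F U. \<psi> U (\<phi> U s) = \<psi>' U (\<phi>' U s))"
  by (fastforce simp: sheaf_comp_def fun_eq_iff restrict_def split: if_splits)

lemma sheaf_comp_hom: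
  assumes F: "is_presheaf X F" and \<phi>: "\<phi> \<in> sheaf_hom X F G" and \<psi>: "\<psi> \<in> sheaf_hom X G H"
  shows "sheaf_comp X F \<psi> \<phi> \<in> sheaf_hom X F H"
  unfolding sheaf_hom_def
proof (intro CollectI conjI ballI)
  show "sheaf_comp X F \<psi> \<phi> \<in> (\<Pi>\<^sub>E U\<in>opens X. sect F U \<rightarrow>\<^sub>E sect H U)"
    by (auto simp: sheaf_comp_def intro!: sheaf_hom_mem[OF \<psi>] sheaf_hom_mem[OF \<phi>])
  fix U V s assume "U \<in> opens X" "V \<in> opens_in X U" "s \<in> sect F U"
  then show "sheaf_comp X F \<psi> \<phi> V (res F U V s) = res H U V (sheaf_comp X F \<psi> \<phi> U s)"
    by (simp add: presheaf_res(1)[OF F] sheaf_hom_res[OF \<phi>] sheaf_hom_res[OF \<psi>] sheaf_hom_mem[OF \<phi>])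
qed

lemma category_sheaf_cat:
  "category (sheaf_cat X :: (('x, 'a) presheaf, ('x, 'a, 'a) sheaf_mor) cat)"
proof -
  have id: "sheaf_id X F \<in> sheaf_hom X F F" if "is_sheaf X F" for F :: "('x, 'a) presheaf"
    using that presheaf_res(1)[of X F] by (auto simp: sheaf_id_def sheaf_hom_def is_sheaf_def)
  have comp: "sheaf_comp X F \<psi> \<phi> \<in> sheaf_hom X F H"
    if "is_sheaf X F" "\<phi> \<in> sheaf_hom X F G" "\<psi> \<in> sheaf_hom X G H"
    for F G H :: "('x, 'a) presheaf" and \<phi> \<psi>
    using that sheaf_comp_hom by (auto simp: is_sheaf_def)
  have unit: "sheaf_comp X F \<phi> (sheaf_id X F) = \<phi> \<and> sheaf_comp X F (sheaf_id X G) \<phi> = \<phi>"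
    if "is_sheaf X F" "is_sheaf X G" "\<phi> \<in> sheaf_hom X F G" for F G :: "('x, 'a) presheaf" and \<phi>
    using comp[OF that(1) id[OF that(1)] that(3)] comp[OF that(1,3) id[OF that(2)]] that(3)
    by (auto intro!: sheaf_hom_eqI[of _ X F G] simp: sheaf_hom_mem[OF that(3)])
      (simp_all add: sheaf_id_def sheaf_hom_mem[OF that(3)])
  have assoc: "sheaf_comp X F \<chi> (sheaf_comp X F \<psi> \<phi>) = sheaf_comp X F (sheaf_comp X G \<chi> \<psi>) \<phi>"
    if "\<phi> \<in> sheaf_hom X F G" for F G :: "('x, 'a) presheaf"
      and \<phi> \<psi> \<chi> :: "('x, 'a, 'a) sheaf_mor"
    by (simp add: sheaf_comp_eq_iff sheaf_hom_mem[OF that])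
  show ?thesis
    unfolding category_def sheaf_cat_def cat.simps mem_Collect_eq
    using id comp unit assoc by blast
qed

section \<open>Inverse image along the identity\<close>

text \<open>The identity is restricted to \<open>topspace X\<close> because this is the identity of
  \<open>X\<close> in \<open>top_cat\<close>, and hence the value of the constant simplicial space
  on every arrow.\<close>

abbreviation pull_id :: "'x topology \<Rightarrow> ('x, 'a) presheaf \<Rightarrow> ('x, 'x \<Rightarrow> ('x, 'a) germ) presheaf"
  where "pull_id X \<equiv> pull X X (\<lambda>x\<in>topspace X. x)"

text \<open>The surjectivity in \<open>pull_id_iso_bij\<close>: a family of germs that is locally
  given by sections comes from one section, by gluing in the sheaf \<open>F\<close>.\<close>

lemma sect_pull_id:
  "is_sheaf X F \<Longrightarrow> openin X U \<Longrightarrow> sect (pull_id X F) U = pull_id_iso X F U ` sect F U"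
  using bij_betw_imp_surj_on[OF pull_id_iso_bij] by (rule sym)

lemma pull_id_iso_apply:
  "openin X U \<Longrightarrow> s \<in> sect F U \<Longrightarrow> pull_id_iso X F U s = (\<lambda>x\<in>U. germ X F x U s)"
  by (simp add: pull_id_iso_def)

lemma pull_id_iso_mem:
  "is_sheaf X F \<Longrightarrow> openin X U \<Longrightarrow> s \<in> sect F U \<Longrightarrow>
    pull_id_iso X F U s \<in> sect (pull_id X F) U"
  by (simp only: sect_pull_id imageI)

text \<open>Naturality of the isomorphism with the inverse image. At a point \<open>x\<close> both
  sides are the germ of \<open>\<phi> U s\<close>, since the stalk map sends germs of
  \<open>s\<close> to germs of its image.\<close>

lemma pull_map_pull_id_iso:
  assumes F: "is_sheaf X F" and G: "is_sheaf X G" and \<phi>: "\<phi> \<in> sheaf_hom X F G"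
    and U: "openin X U" and s: "s \<in> sect F U"
  shows "pull_map X X (\<lambda>x\<in>topspace X. x) F G \<phi> U (pull_id_iso X F U s) =
    pull_id_iso X G U (\<phi> U s)"
proof -
  have "is_presheaf X F" "is_presheaf X G" using F G by (auto simp: is_sheaf_def)
  then show ?thesis
    using pull_id_iso_mem[OF F U s] openin_subset[OF U] U s stalk_map_germ[OF _ _ \<phi> U _ s]
      sheaf_hom_mem[OF \<phi> U s]
    by (auto simp: pull_map_def pull_id_iso_apply subset_iff intro!: restrict_ext)
qed

text \<open>The coherence isomorphism undoes passing to germs: at \<open>x\<close> it evaluates the
  germ of \<sigma> at \<open>x\<close>, and every representative has the value
  \<open>\<sigma> x\<close> there.\<close>

lemma pull_comp_iso_pull_id_iso:
  assumes U: "openin X U" and \<sigma>: "\<sigma> \<in> sect (pull_id X F) U"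
  shows "pull_comp_iso X X X (\<lambda>x\<in>topspace X. x) (\<lambda>x\<in>topspace X. x) F U
    (pull_id_iso X (pull_id X F) U \<sigma>) = \<sigma>"
proof -
  have \<sigma>': "\<sigma> \<in> pull_sect X X (\<lambda>x\<in>topspace X. x) F U" using U \<sigma> by simp
  then have "\<sigma> \<in> extensional U" by (simp add: pull_sect_def)
  moreover have "pull_id_iso X (pull_id X F) U \<sigma> \<in> sect (pull_id X (pull_id X F)) U"
    by (rule pull_id_iso_mem[OF is_sheaf_pull U \<sigma>])
  ultimately show ?thesis
    using U openin_subset[OF U] pull_comp_iso_germ[OF U _ \<sigma>'] \<sigma>
    by (intro extensionalityI[of _ U])
      (auto simp del: pull_simps simp: pull_comp_iso_def pull_id_iso_apply subset_iff)
qed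

text \<open>Used as a rewrite rule that reduces conditions on sections of an inverse image to
  sections of the sheaf itself; two applications deal with a double inverse image.\<close>

lemma ball_sect_pull_id:
  assumes "is_sheaf X F"
  shows "(\<forall>U\<in>opens X. \<forall>\<sigma>\<in>sect (pull_id X F) U. P U \<sigma>) \<longleftrightarrow>
    (\<forall>U\<in>opens X. \<forall>s\<in>sect F U. P U (pull_id_iso X F U s))"
  using sect_pull_id[OF assms] by auto

text \<open>Composition with an isomorphism is bijective. This is what lets structure maps out of an
  inverse image be exchanged for maps between the sheaves themselves without loss.\<close>

lemma precompose_pull_id_iso_bij:
  assumes F: "is_sheaf X F"
  shows "bij_betw (\<lambda>\<phi>. sheaf_comp X F \<phi> (pull_id_iso X F))
    (sheaf_hom X (pull_id X F) G) (sheaf_hom X F G)"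
  unfolding bij_betw_def
proof
  have P: "is_presheaf X F" "is_presheaf X (pull_id X F)"
    using F is_sheaf_pull by (auto simp: is_sheaf_def)
  show "inj_on (\<lambda>\<phi>. sheaf_comp X F \<phi> (pull_id_iso X F)) (sheaf_hom X (pull_id X F) G)"
  proof (rule inj_onI)
    fix \<phi> \<psi> assume *: "\<phi> \<in> sheaf_hom X (pull_id X F) G" "\<psi> \<in> sheaf_hom X (pull_id X F) G"
      "sheaf_comp X F \<phi> (pull_id_iso X F) = sheaf_comp X F \<psi> (pull_id_iso X F)"
    then have "\<forall>U\<in>opens X. \<forall>\<sigma>\<in>sect (pull_id X F) U. \<phi> U \<sigma> = \<psi> U \<sigma>"
      unfolding ball_sect_pull_id[OF F] by (simp add: sheaf_comp_eq_iff)
    then show "\<phi> = \<psi>" by (intro sheaf_hom_eqI[OF *(1,2)]) auto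
  qed
  show "(\<lambda>\<phi>. sheaf_comp X F \<phi> (pull_id_iso X F)) ` sheaf_hom X (pull_id X F) G = sheaf_hom X F G"
  proof
    show "(\<lambda>\<phi>. sheaf_comp X F \<phi> (pull_id_iso X F)) ` sheaf_hom X (pull_id X F) G \<subseteq> sheaf_hom X F G"
      using sheaf_comp_hom[OF P(1) pull_id_iso_hom[OF F]] by blast
    show "sheaf_hom X F G \<subseteq> (\<lambda>\<phi>. sheaf_comp X F \<phi> (pull_id_iso X F)) ` sheaf_hom X (pull_id X F) G"
    proof
      fix \<psi> assume \<psi>: "\<psi> \<in> sheaf_hom X F G"
      \<comment> \<open>The inverse isomorphism, taken over each open set and made extensional so
        that it can be a member of \<open>sheaf_hom\<close>.\<close>
      define j where "j = (\<lambda>U\<in>opens X. \<lambda>\<sigma>\<in>sect (pull_id X F) U.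
        inv_into (sect F U) (pull_id_iso X F U) \<sigma>)"
      have j: "j U (pull_id_iso X F U s) = s" if "openin X U" "s \<in> sect F U" for U s
        using that pull_id_iso_mem[OF F that] bij_betw_inv_into_left[OF pull_id_iso_bij[OF F]]
        by (simp add: j_def del: pull_simps)
      have "j \<in> sheaf_hom X (pull_id X F) F"
        unfolding sheaf_hom_def
      proof (intro CollectI conjI)
        have "\<forall>U\<in>opens X. \<forall>\<sigma>\<in>sect (pull_id X F) U. j U \<sigma> \<in> sect F U"
          unfolding ball_sect_pull_id[OF F] by (simp add: j)
        then show "j \<in> (\<Pi>\<^sub>E U\<in>opens X. sect (pull_id X F) U \<rightarrow>\<^sub>E sect F U)"
          by (auto simp: j_def simp del: pull_simps)
        \<comment> \<open>On a family of germs of \<open>s\<close>, restriction yields the family of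
          germs of the restriction of \<open>s\<close>, which \<open>j\<close> takes back. The
          quantifier over \<open>V\<close> comes last so that \<open>ball_sect_pull_id\<close>
          applies.\<close>
        have "\<forall>U\<in>opens X. \<forall>\<sigma>\<in>sect (pull_id X F) U. \<forall>V\<in>opens_in X U.
            j V (res (pull_id X F) U V \<sigma>) = res F U V (j U \<sigma>)"
          unfolding ball_sect_pull_id[OF F]
          by (simp add: j presheaf_res(1)[OF P(1)] flip: sheaf_hom_res[OF pull_id_iso_hom[OF F]])
        then show "\<forall>U\<in>opens X. \<forall>V\<in>opens_in X U. \<forall>\<sigma>\<in>sect (pull_id X F) U.
            j V (res (pull_id X F) U V \<sigma>) = res F U V (j U \<sigma>)"
          by blast
      qed
      then have h: "sheaf_comp X (pull_id X F) \<psi> j \<in> sheaf_hom X (pull_id X F) G"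
        by (rule sheaf_comp_hom[OF P(2) _ \<psi>])
      moreover have "sheaf_comp X F (sheaf_comp X (pull_id X F) \<psi> j) (pull_id_iso X F) = \<psi>"
        using sheaf_comp_hom[OF P(1) pull_id_iso_hom[OF F] h] \<psi> pull_id_iso_mem[OF F]
        by (intro sheaf_hom_eqI[of _ X F G]) (auto simp: j simp del: pull_simps)
      ultimately show "\<psi> \<in> (\<lambda>\<phi>. sheaf_comp X F \<phi> (pull_id_iso X F)) ` sheaf_hom X (pull_id X F) G"
        by (metis imageI)
    qed
  qed
qed

section \<open>Sheaves on the constant simplicial space as cosimplicial sheaves\<close>

lemma simplex_cat_simps:
  "cobj simplex_cat = UNIV"
  "cid simplex_cat p \<in> chom simplex_cat p p"
  "\<alpha> \<in> chom simplex_cat p q \<Longrightarrow> \<beta> \<in> chom simplex_cat q r \<Longrightarrow>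
    ccomp simplex_cat p q r \<beta> \<alpha> \<in> chom simplex_cat p r"
proof -
  show U: "cobj simplex_cat = UNIV" by (simp add: simplex_cat_def)
  show "cid simplex_cat p \<in> chom simplex_cat p p"
    "\<alpha> \<in> chom simplex_cat p q \<Longrightarrow> \<beta> \<in> chom simplex_cat q r \<Longrightarrow>
      ccomp simplex_cat p q r \<beta> \<alpha> \<in> chom simplex_cat p r"
    using category_simplex_cat unfolding category_def U by simp_all
qed

lemma constant_simplicial_space_simps:
  "fobj (constant_simplicial_space X) p = X"
  "\<alpha> \<in> chom simplex_cat p q \<Longrightarrow> fmap (constant_simplicial_space X) q p \<alpha> = (\<lambda>x\<in>topspace X. x)"
  by (simp_all add: constant_simplicial_space_def const_functor_def op_cat_def simplex_cat_simps
      top_cat_def)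

text \<open>Only the dependence on \<alpha> is restricted: every natural number is an object of
  \<open>simplex_cat\<close>, so extensionality in \<open>p\<close> and \<open>q\<close> is
  automatic.\<close>

definition csheaf_of_ssheaf :: "'x topology \<Rightarrow> ('x, 'a) ssheaf \<Rightarrow> ('x, 'a) csheaf" where
  "csheaf_of_ssheaf X S = \<lparr>fobj = level S,
     fmap = (\<lambda>p q. \<lambda>\<alpha>\<in>chom simplex_cat p q.
       sheaf_comp X (level S p) (strmap S p q \<alpha>) (pull_id_iso X (level S p)))\<rparr>"

lemma csheaf_of_ssheaf_simps [simp]:
  "fobj (csheaf_of_ssheaf X S) = level S"
  "\<alpha> \<in> chom simplex_cat p q \<Longrightarrow> fmap (csheaf_of_ssheaf X S) p q \<alpha> =
    sheaf_comp X (level S p) (strmap S p q \<alpha>) (pull_id_iso X (level S p))"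
  by (simp_all add: csheaf_of_ssheaf_def)

text \<open>What is left of a sheaf on the constant simplicial space without functoriality. Over
  such data the functoriality conditions of the two sides can be compared.\<close>

definition ssheaf_data :: "'x topology \<Rightarrow> ('x, 'a) ssheaf set" where
  "ssheaf_data X = {S. (\<forall>p. is_sheaf X (level S p)) \<and>
     (\<forall>p q. strmap S p q \<in>
        (\<Pi>\<^sub>E \<alpha>\<in>chom simplex_cat p q. sheaf_hom X (pull_id X (level S p)) (level S q)))}"

text \<open>The identity condition is the same on both sides, being stated with
  \<open>pull_id_iso\<close> already. The composition conditions agree because families of germs
  exhaust the double inverse image.\<close>

lemma is_ssheaf_constant_iff:
  assumes S: "S \<in> ssheaf_data X"
  shows "is_ssheaf (constant_simplicial_space X) S \<longleftrightarrow>
    is_functor simplex_cat (sheaf_cat X) (csheaf_of_ssheaf X S)"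
proof -
  let ?K = "csheaf_of_ssheaf X S" and ?i = "\<lambda>x\<in>topspace X. x" and ?L = "level S" and ?H = "strmap S"
  have L: "is_sheaf X (?L p)" for p using S by (simp add: ssheaf_data_def)
  have H: "?H p q \<alpha> \<in> sheaf_hom X (pull_id X (?L p)) (?L q)" if "\<alpha> \<in> chom simplex_cat p q" for p q \<alpha>
    using S that unfolding ssheaf_data_def by (blast dest: PiE_mem)
  have Hext: "?H p q \<in> (\<Pi>\<^sub>E \<alpha>\<in>chom simplex_cat p q. sheaf_hom X (pull_id X (?L p)) (?L q))" for p q
    using S by (simp add: ssheaf_data_def)
  have K: "fmap ?K p q \<alpha> \<in> sheaf_hom X (?L p) (?L q)" if "\<alpha> \<in> chom simplex_cat p q" for p q \<alpha>
    unfolding csheaf_of_ssheaf_simps(2)[OF that]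
    by (rule bspec[OF bij_betwE[OF precompose_pull_id_iso_bij[OF L]] H[OF that]])
  \<comment> \<open>Both conditions are tested on a section \<open>s\<close> of \<open>?L p\<close>,
    the first one after passing to germs twice. The coherence isomorphism removes one of these
    passages, which leaves the composite arrow of \<open>?K\<close> at \<open>s\<close>; on the
    other side naturality moves the outer passage behind \<open>?H p q \<alpha>\<close>, which
    leaves the two arrows of \<open>?K\<close> applied in turn.\<close>
  have comp: "sheaf_comp X (pull_id X (pull_id X (?L p))) (?H p r (ccomp simplex_cat p q r \<beta> \<alpha>))
        (pull_comp_iso X X X ?i ?i (?L p)) =
      sheaf_comp X (pull_id X (pull_id X (?L p))) (?H q r \<beta>)
        (pull_map X X ?i (pull_id X (?L p)) (?L q) (?H p q \<alpha>)) \<longleftrightarrow>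
      fmap ?K p r (ccomp simplex_cat p q r \<beta> \<alpha>) =
      sheaf_comp X (?L p) (fmap ?K q r \<beta>) (fmap ?K p q \<alpha>)"
    if \<alpha>: "\<alpha> \<in> chom simplex_cat p q" and \<beta>: "\<beta> \<in> chom simplex_cat q r" for p q r \<alpha> \<beta>
    unfolding sheaf_comp_eq_iff ball_sect_pull_id[OF is_sheaf_pull] ball_sect_pull_id[OF L]
      csheaf_of_ssheaf_simps(2)[OF \<alpha>] csheaf_of_ssheaf_simps(2)[OF \<beta>]
      csheaf_of_ssheaf_simps(2)[OF simplex_cat_simps(3)[OF \<alpha> \<beta>]]
    by (simp del: pull_simps add: pull_id_iso_mem[OF L] pull_comp_iso_pull_id_iso
        pull_map_pull_id_iso[OF is_sheaf_pull L H[OF \<alpha>]] sheaf_hom_mem[OF H[OF \<alpha>]])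
  have ssheaf: "is_ssheaf (constant_simplicial_space X) S \<longleftrightarrow>
      (\<forall>p. fmap ?K p p (cid simplex_cat p) = sheaf_id X (?L p)) \<and>
      (\<forall>p q r. \<forall>\<alpha>\<in>chom simplex_cat p q. \<forall>\<beta>\<in>chom simplex_cat q r.
        fmap ?K p r (ccomp simplex_cat p q r \<beta> \<alpha>) =
        sheaf_comp X (?L p) (fmap ?K q r \<beta>) (fmap ?K p q \<alpha>))"
    \<comment> \<open>The maps of the constant simplicial space are known only on arrows of
      \<open>simplex_cat\<close>, so \<open>PiE_cong\<close> has to supply that \<alpha> is one. The
      rule for \<open>fmap\<close> is withheld at first so that \<open>comp\<close> matches.\<close>
    using L Hext comp
    by (simp add: is_ssheaf_def constant_simplicial_space_simps simplex_cat_simps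
        cong: PiE_cong del: csheaf_of_ssheaf_simps(2))
       (simp add: simplex_cat_simps)
  have "fmap ?K p q \<in> (chom simplex_cat p q \<rightarrow>\<^sub>E sheaf_hom X (?L p) (?L q))" for p q
    using K by (auto simp: csheaf_of_ssheaf_def)
  then have "is_functor simplex_cat (sheaf_cat X) ?K \<longleftrightarrow>
      (\<forall>p. fmap ?K p p (cid simplex_cat p) = sheaf_id X (?L p)) \<and>
      (\<forall>p q r. \<forall>\<alpha>\<in>chom simplex_cat p q. \<forall>\<beta>\<in>chom simplex_cat q r.
        fmap ?K p r (ccomp simplex_cat p q r \<beta> \<alpha>) =
        sheaf_comp X (?L p) (fmap ?K q r \<beta>) (fmap ?K p q \<alpha>))"
    using L by (simp add: is_functor_def sheaf_cat_def simplex_cat_simps(1) PiE_UNIV_domain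
        del: csheaf_of_ssheaf_simps(2))
  then show ?thesis using ssheaf by simp
qed

lemma is_ssheaf_constant_data:
  "is_ssheaf (constant_simplicial_space X) S \<Longrightarrow> S \<in> ssheaf_data X"
  by (simp add: is_ssheaf_def ssheaf_data_def constant_simplicial_space_simps cong: PiE_cong)

text \<open>The levels are kept, and \<open>precompose_pull_id_iso_bij\<close> gives a bijection
  between the possible structure maps for each arrow. Functoriality is preserved and reflected by
  \<open>is_ssheaf_constant_iff\<close>.\<close>

lemma csheaf_of_ssheaf_bij:
  fixes X :: "'x topology"
  shows "bij_betw (csheaf_of_ssheaf X :: ('x, 'a) ssheaf \<Rightarrow> _)
    {S. is_ssheaf (constant_simplicial_space X) S}
    {K. is_functor simplex_cat (sheaf_cat X) K}"
  unfolding bij_betw_def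
proof
  show "inj_on (csheaf_of_ssheaf X :: ('x, 'a) ssheaf \<Rightarrow> _)
      {S. is_ssheaf (constant_simplicial_space X) S}"
  proof (rule inj_onI)
    fix S T :: "('x, 'a) ssheaf"
    assume "S \<in> {S. is_ssheaf (constant_simplicial_space X) S}"
      "T \<in> {S. is_ssheaf (constant_simplicial_space X) S}"
      and eq: "csheaf_of_ssheaf X S = csheaf_of_ssheaf X T"
    then have S: "S \<in> ssheaf_data X" and T: "T \<in> ssheaf_data X"
      using is_ssheaf_constant_data by auto
    \<comment> \<open>The levels come first: only then do both structure maps lie in one hom-set,
      where precomposition is injective.\<close>
    have level: "level S = level T"
      using arg_cong[OF eq, of fobj] by simp
    have Sh: "strmap S p q \<in> (\<Pi>\<^sub>E \<alpha>\<in>chom simplex_cat p q.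
          sheaf_hom X (pull_id X (level S p)) (level S q))"
      and Th: "strmap T p q \<in> (\<Pi>\<^sub>E \<alpha>\<in>chom simplex_cat p q.
          sheaf_hom X (pull_id X (level S p)) (level S q))"
      and L: "is_sheaf X (level S p)" for p q
      using S T by (simp_all add: ssheaf_data_def level)
    have "strmap S p q = strmap T p q" for p q
    proof (rule PiE_ext[OF Sh Th])
      fix \<alpha> assume \<alpha>: "\<alpha> \<in> chom simplex_cat p q"
      have "fmap (csheaf_of_ssheaf X S) p q \<alpha> = fmap (csheaf_of_ssheaf X T) p q \<alpha>"
        using eq by simp
      then show "strmap S p q \<alpha> = strmap T p q \<alpha>"
        using \<alpha> PiE_mem[OF Sh \<alpha>] PiE_mem[OF Th \<alpha>]
        by (intro inj_onD[OF bij_betw_imp_inj_on[OF precompose_pull_id_iso_bij[OF L]]])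
          (simp_all add: level)
    qed
    then show "S = T" using level by (simp add: ssheaf.equality fun_eq_iff)
  qed
  show "(csheaf_of_ssheaf X :: ('x, 'a) ssheaf \<Rightarrow> _) `
        {S. is_ssheaf (constant_simplicial_space X) S} =
      {K. is_functor simplex_cat (sheaf_cat X) K}"
  proof
    show "(csheaf_of_ssheaf X :: ('x, 'a) ssheaf \<Rightarrow> _) `
        {S. is_ssheaf (constant_simplicial_space X) S} \<subseteq>
        {K. is_functor simplex_cat (sheaf_cat X) K}"
      using is_ssheaf_constant_iff is_ssheaf_constant_data by blast
    show "{K. is_functor simplex_cat (sheaf_cat X) K} \<subseteq>
        (csheaf_of_ssheaf X :: ('x, 'a) ssheaf \<Rightarrow> _) `
        {S. is_ssheaf (constant_simplicial_space X) S}"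
    proof
      fix K :: "('x, 'a) csheaf" assume "K \<in> {K. is_functor simplex_cat (sheaf_cat X) K}"
      then have K: "is_functor simplex_cat (sheaf_cat X) K" by simp
      then have L: "is_sheaf X (fobj K p)"
        and Kh: "fmap K p q \<in> (chom simplex_cat p q \<rightarrow>\<^sub>E sheaf_hom X (fobj K p) (fobj K q))" for p q
        by (auto simp: is_functor_def sheaf_cat_def simplex_cat_simps(1) PiE_UNIV_domain)
      let ?pre = "\<lambda>p \<phi>. sheaf_comp X (fobj K p) \<phi> (pull_id_iso X (fobj K p))"
      let ?hom = "\<lambda>p q. sheaf_hom X (pull_id X (fobj K p)) (fobj K q)"
      have bij: "bij_betw (?pre p) (?hom p q) (sheaf_hom X (fobj K p) (fobj K q))" for p q
        by (rule precompose_pull_id_iso_bij[OF L])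
      \<comment> \<open>The preimage of \<open>K\<close>, found arrow by arrow. It is functorial
        because its image turns out to be the functor \<open>K\<close>.\<close>
      define S where "S = \<lparr>level = fobj K,
        strmap = (\<lambda>p q. \<lambda>\<alpha>\<in>chom simplex_cat p q. inv_into (?hom p q) (?pre p) (fmap K p q \<alpha>))\<rparr>"
      have data: "S \<in> ssheaf_data X"
        using L bij_betwE[OF bij_betw_inv_into[OF bij]] PiE_mem[OF Kh]
        by (auto simp: ssheaf_data_def S_def)
      have "fmap (csheaf_of_ssheaf X S) p q = fmap K p q" for p q
      proof (rule extensionalityI[of _ "chom simplex_cat p q"])
        fix \<alpha> assume \<alpha>: "\<alpha> \<in> chom simplex_cat p q"
        then show "fmap (csheaf_of_ssheaf X S) p q \<alpha> = fmap K p q \<alpha>"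
          using bij_betw_inv_into_right[OF bij PiE_mem[OF Kh \<alpha>]] by (simp add: S_def)
      qed (use Kh in \<open>auto simp: csheaf_of_ssheaf_def PiE_def\<close>)
      then have "csheaf_of_ssheaf X S = K"
        by (intro fctr.equality) (auto simp: S_def)
      then show "K \<in> csheaf_of_ssheaf X ` {S. is_ssheaf (constant_simplicial_space X) S}"
        using is_ssheaf_constant_iff[OF data] K by blast
    qed
  qed
qed

text \<open>Compatibility, tested on the germs of a section, becomes naturality by
  \<open>pull_map_pull_id_iso\<close>. The two sets are equal, and not merely in bijection, since a
  family over all natural numbers is extensional anyway.\<close>

lemma ssheaf_hom_constant_eq:
  assumes S: "S \<in> ssheaf_data X" and T: "T \<in> ssheaf_data X"
  shows "ssheaf_hom (constant_simplicial_space X) S T =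
    {\<phi>. nat_trans simplex_cat (sheaf_cat X) (csheaf_of_ssheaf X S) (csheaf_of_ssheaf X T) \<phi>}"
proof -
  let ?i = "\<lambda>x\<in>topspace X. x"
  have L: "is_sheaf X (level S p)" "is_sheaf X (level T p)" for p
    using S T by (simp_all add: ssheaf_data_def)
  have "sheaf_comp X (pull_id X (level S p)) (\<phi> q) (strmap S p q \<alpha>) =
      sheaf_comp X (pull_id X (level S p)) (strmap T p q \<alpha>)
        (pull_map X X ?i (level S p) (level T p) (\<phi> p)) \<longleftrightarrow>
      sheaf_comp X (level S p) (\<phi> q) (fmap (csheaf_of_ssheaf X S) p q \<alpha>) =
      sheaf_comp X (level S p) (fmap (csheaf_of_ssheaf X T) p q \<alpha>) (\<phi> p)"
    if \<alpha>: "\<alpha> \<in> chom simplex_cat p q" and \<phi>: "\<And>p. \<phi> p \<in> sheaf_hom X (level S p) (level T p)"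
    for \<phi> p q \<alpha>
    unfolding sheaf_comp_eq_iff ball_sect_pull_id[OF L(1)] csheaf_of_ssheaf_simps(2)[OF \<alpha>]
    by (simp add: pull_map_pull_id_iso[OF L \<phi>] sheaf_hom_mem[OF \<phi>])
  then show ?thesis
    by (auto simp: Pi_iff ssheaf_hom_def nat_trans_def constant_simplicial_space_simps simplex_cat_simps(1)
        sheaf_cat_def PiE_UNIV_domain simp del: csheaf_of_ssheaf_simps(2))
qed

section \<open>The equivalence\<close>

theorem lemma2p12:
  fixes X :: "'x topology"
  shows "equivalent_categories
           (csheaf_cat X :: (('x, 'a) csheaf, nat \<Rightarrow> ('x, 'a, 'a) sheaf_mor) cat)
           (ssheaf_cat (constant_simplicial_space X) ::
              (('x, 'a) ssheaf, nat \<Rightarrow> ('x, 'a, 'a) sheaf_mor) cat)"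
proof (rule equivalent_categories_bij_objects[where \<Phi> = "csheaf_of_ssheaf X"])
  \<comment> \<open>The criterion asks for the category axioms at the target of \<Phi> only, and
    there they hold because cosimplicial sheaves form a functor category.\<close>
  show "category (csheaf_cat X :: (('x, 'a) csheaf, nat \<Rightarrow> ('x, 'a, 'a) sheaf_mor) cat)"
    unfolding csheaf_cat_def
    by (rule category_functor_cat[OF category_simplex_cat category_sheaf_cat])
  show "bij_betw (csheaf_of_ssheaf X)
      (cobj (ssheaf_cat (constant_simplicial_space X) ::
        (('x, 'a) ssheaf, nat \<Rightarrow> ('x, 'a, 'a) sheaf_mor) cat))
      (cobj (csheaf_cat X))"
    using csheaf_of_ssheaf_bij by (simp add: ssheaf_cat_def csheaf_cat_def functor_cat_def)
qed (auto simp: ssheaf_cat_def csheaf_cat_def functor_cat_def sheaf_cat_def simplex_cat_simps(1)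
    constant_simplicial_space_simps ssheaf_hom_constant_eq is_ssheaf_constant_data fun_eq_iff)

end
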